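(* Let $G$ be a totally disconnected, locally compact group and let $\mathcal{A}$ be a group of automorphisms of $G$. Suppose that $\mathcal{A}$ has a hyperbolic orbit in the metric space $(\mathcal{B}(G),d)$ of compact open subgroups of $G$; that is, there is a compact open subgroup $V\leqslant G$ such that $\mathcal{A}.V=\{\alpha(V):\alpha\in\mathcal{A}\}$, with the restriction of $d$, is a hyperbolic metric space. Then the flat-rank of $\mathcal{A}$ is at most $1$.
   Context: Automorphisms of a topological group are bicontinuous. $\mathcal{B}(G)$ denotes the set of compact open subgroups of $G$ with the metric $d(V,W)=\log\bigl(|V:V\cap W|\cdot|W:V\cap W|\bigr)$; automorphisms of $G$ act on it by isometries. A (not necessarily geodesic) metric space $X$ is $\delta$-hyperbolic if $(x\cdot y)_w\ge\min\{(x\cdot z)_w,(y\cdot z)_w\}-\delta$ for all $w,x,y,z\in X$, where $(x\cdot y)_w=\tfrac12\bigl(d(x,w)+d(y,w)-d(x,y)\bigr)$; it is hyperbolic if it is $\delta$-hyperbolic for some $\delta\ge 0$. The scale of an automorphism $\alpha$ of $G$ is $s_G(\alpha)=\min\{|\alpha(O):\alpha(O)\cap O| : O\leqslant G \text{ compact and open}\}$. A compact open subgroup $O$ is minimizing for $\alpha$ if this minimum is attained at $O$. A group $\mathcal{H}$ of automorphisms of $G$ is flat if there is a compact open subgroup $O$ that is minimizing for every $\alpha\in\mathcal{H}$. In that case put $\mathcal{H}_1=\{\alpha\in\mathcal{H}:\alpha(O)=O\}$; it is known that $\mathcal{H}_1$ is normal in $\mathcal{H}$, independent of the choice of $O$,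 and that $\mathcal{H}/\mathcal{H}_1$ is free abelian. The rank of $\mathcal{H}$ is the rank of $\mathcal{H}/\mathcal{H}_1$. The flat-rank of a group $\mathcal{A}$ of automorphisms of $G$ is the supremum of the ranks of all flat subgroups of $\mathcal{A}$. *)

theory Defs
  imports "HOL-Analysis.Analysis" "HOL-Algebra.Bij" "HOL-Algebra.Free_Abelian_Groups"
begin

section \<open>Totally disconnected, locally compact groups\<close>

locale topological_group = group G for G (structure) +
  fixes T :: "'a topology"
  assumes topspace_eq [simp]: "topspace T = carrier G"
    and continuous_mult: "continuous_map (prod_topology T T) T (\<lambda>(x, y). x \<otimes> y)"
    and continuous_inv: "continuous_map T T (\<lambda>x. inv x)"

definition totally_disconnected_space :: "'a topology \<Rightarrow> bool" where
  "totally_disconnected_space X \<longleftrightarrow> (\<forall>x \<in> topspace X. connected_component_of_set X x = {x})"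

text \<open>In a topological group, total disconnectedness entails the Hausdorff property, so the latter
  is not required separately.\<close>

locale tdlc_group = topological_group +
  assumes totally_disconnected: "totally_disconnected_space T"
    and locally_compact: "locally_compact_space T"

definition top_Aut :: "('a, 'b) monoid_scheme \<Rightarrow> 'a topology \<Rightarrow> ('a \<Rightarrow> 'a) monoid" where
  "top_Aut G T = (AutoGroup G)\<lparr>carrier := {\<alpha> \<in> auto G. homeomorphic_map T T \<alpha>}\<rparr>"

definition compact_open_subgroups :: "('a, 'b) monoid_scheme \<Rightarrow> 'a topology \<Rightarrow> 'a set set" where
  "compact_open_subgroups G T = {V. subgroup V G \<and> compactin T V \<and> openin T V}"

text \<open>\<open>subgroup_index G V U\<close> is $|V : U|$. It is only used for $U$ open in a compact $V$, where
  it is finite.\<close>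

definition subgroup_index :: "('a, 'b) monoid_scheme \<Rightarrow> 'a set \<Rightarrow> 'a set \<Rightarrow> nat" where
  "subgroup_index G V U = card (rcosets\<^bsub>G\<lparr>carrier := V\<rparr>\<^esub> U)"

definition subgroup_dist :: "('a, 'b) monoid_scheme \<Rightarrow> 'a set \<Rightarrow> 'a set \<Rightarrow> real" where
  "subgroup_dist G V W =
     ln (real (subgroup_index G V (V \<inter> W) * subgroup_index G W (V \<inter> W)))"


section \<open>Hyperbolicity of metric spaces that need not be geodesic\<close>

definition Gromov_product :: "('x \<Rightarrow> 'x \<Rightarrow> real) \<Rightarrow> 'x \<Rightarrow> 'x \<Rightarrow> 'x \<Rightarrow> real" where
  "Gromov_product d w x y = (d x w + d y w - d x y) / 2"

definition delta_hyperbolic :: "real \<Rightarrow> 'x set \<Rightarrow> ('x \<Rightarrow> 'x \<Rightarrow> real) \<Rightarrow> bool" where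
  "delta_hyperbolic \<delta> X d \<longleftrightarrow>
     (\<forall>w\<in>X. \<forall>x\<in>X. \<forall>y\<in>X. \<forall>z\<in>X.
        Gromov_product d w x y \<ge> min (Gromov_product d w x z) (Gromov_product d w y z) - \<delta>)"

definition Gromov_hyperbolic :: "'x set \<Rightarrow> ('x \<Rightarrow> 'x \<Rightarrow> real) \<Rightarrow> bool" where
  "Gromov_hyperbolic X d \<longleftrightarrow> (\<exists>\<delta>\<ge>0. delta_hyperbolic \<delta> X d)"


section \<open>Scale, flat groups of automorphisms and flat-rank\<close>

definition aut_scale :: "('a, 'b) monoid_scheme \<Rightarrow> 'a topology \<Rightarrow> ('a \<Rightarrow> 'a) \<Rightarrow> nat" where
  "aut_scale G T \<alpha> =
     (LEAST n. \<exists>V \<in> compact_open_subgroups G T. n = subgroup_index G (\<alpha> ` V) (\<alpha> ` V \<inter> V))"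

definition minimizing :: "('a, 'b) monoid_scheme \<Rightarrow> 'a topology \<Rightarrow> ('a \<Rightarrow> 'a) \<Rightarrow> 'a set \<Rightarrow> bool" where
  "minimizing G T \<alpha> V \<longleftrightarrow>
     V \<in> compact_open_subgroups G T \<and> subgroup_index G (\<alpha> ` V) (\<alpha> ` V \<inter> V) = aut_scale G T \<alpha>"

definition minimizing_for_all ::
    "('a, 'b) monoid_scheme \<Rightarrow> 'a topology \<Rightarrow> ('a \<Rightarrow> 'a) set \<Rightarrow> 'a set \<Rightarrow> bool" where
  "minimizing_for_all G T H V \<longleftrightarrow>
     V \<in> compact_open_subgroups G T \<and> (\<forall>\<alpha>\<in>H. minimizing G T \<alpha> V)"

definition flat :: "('a, 'b) monoid_scheme \<Rightarrow> 'a topology \<Rightarrow> ('a \<Rightarrow> 'a) set \<Rightarrow> bool" where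
  "flat G T H \<longleftrightarrow> subgroup H (top_Aut G T) \<and> (\<exists>V. minimizing_for_all G T H V)"

text \<open>The choice of $V$ is immaterial, by \<open>flat_kernel_eq\<close> below.\<close>

definition flat_kernel ::
    "('a, 'b) monoid_scheme \<Rightarrow> 'a topology \<Rightarrow> ('a \<Rightarrow> 'a) set \<Rightarrow> ('a \<Rightarrow> 'a) set" where
  "flat_kernel G T H = (let V = (SOME V. minimizing_for_all G T H V) in {\<alpha>\<in>H. \<alpha> ` V = V})"

definition ecard :: "'a set \<Rightarrow> enat" where
  "ecard S = (if finite S then enat (card S) else \<infinity>)"

text \<open>The rank of a free abelian group is the cardinality of a basis. Bases may be sought in the
  carrier type of the group, see \<open>free_abelian_rank_eqI\<close> below. The value on groups that are
  not free abelian is a convention without meaning; quotients of flat groups are always free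
  abelian.\<close>

definition free_abelian_rank :: "('q, 'b) monoid_scheme \<Rightarrow> enat" where
  "free_abelian_rank Q =
     (if \<exists>S :: 'q set. Q \<cong> free_Abelian_group S
      then ecard (SOME S :: 'q set. Q \<cong> free_Abelian_group S) else 0)"

definition rank_of_flat :: "('a, 'b) monoid_scheme \<Rightarrow> 'a topology \<Rightarrow> ('a \<Rightarrow> 'a) set \<Rightarrow> enat" where
  "rank_of_flat G T H =
     free_abelian_rank ((top_Aut G T)\<lparr>carrier := H\<rparr> Mod flat_kernel G T H)"

definition flat_rank :: "('a, 'b) monoid_scheme \<Rightarrow> 'a topology \<Rightarrow> ('a \<Rightarrow> 'a) set \<Rightarrow> enat" where
  "flat_rank G T A = (SUP H \<in> {H. H \<subseteq> A \<and> flat G T H}. rank_of_flat G T H)"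


section \<open>Well-definedness\<close>

lemma (in topological_group) subgroup_top_Aut:
  "subgroup (carrier (top_Aut G T)) (AutoGroup G)"
proof -
  interpret B: group "BijGroup (carrier G)" by (rule group_BijGroup)
  interpret A: group "AutoGroup G" by (rule AutoGroup)
  have inv_eq: "inv\<^bsub>AutoGroup G\<^esub> \<alpha> = restrict (inv_into (carrier G) \<alpha>) (carrier G)"
    if "\<alpha> \<in> auto G" for \<alpha>
    using B.m_inv_consistent[OF subgroup_auto that] that
    by (simp add: AutoGroup_def inv_BijGroup auto_def)
  show ?thesis
  proof (rule A.subgroupI)
    show "carrier (top_Aut G T) \<subseteq> carrier (AutoGroup G)"
      by (auto simp: top_Aut_def AutoGroup_def)
    have "homeomorphic_map T T (\<lambda>x \<in> carrier G. x)"
      using homeomorphic_map_eq[of T T id] by simp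
    then show "carrier (top_Aut G T) \<noteq> {}"
      using id_in_auto by (auto simp: top_Aut_def)
  next
    fix \<alpha> assume a: "\<alpha> \<in> carrier (top_Aut G T)"
    then have aut: "\<alpha> \<in> auto G" and hom: "homeomorphic_map T T \<alpha>"
      by (auto simp: top_Aut_def)
    then have inj: "inj_on \<alpha> (carrier G)"
      by (auto simp: auto_def Bij_def bij_betw_def)
    obtain g where g: "homeomorphic_maps T T \<alpha> g"
      using hom homeomorphic_map_maps by blast
    have "homeomorphic_map T T g"
      using g homeomorphic_maps_sym homeomorphic_maps_map by blast
    moreover have "g x = inv_into (carrier G) \<alpha> x" if "x \<in> carrier G" for x
    proof -
      have "g x \<in> carrier G" "\<alpha> (g x) = x"
        using g that continuous_map_image_subset_topspace[of T T g]
        by (auto simp: homeomorphic_maps_def)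
      then show ?thesis using inj by (metis inv_into_f_f)
    qed
    ultimately have "homeomorphic_map T T (restrict (inv_into (carrier G) \<alpha>) (carrier G))"
      using homeomorphic_map_eq[of T T g] by simp
    then show "inv\<^bsub>AutoGroup G\<^esub> \<alpha> \<in> carrier (top_Aut G T)"
      using A.inv_closed[of \<alpha>] aut inv_eq[OF aut] by (simp add: top_Aut_def AutoGroup_def)
  next
    fix \<alpha> \<beta> assume a: "\<alpha> \<in> carrier (top_Aut G T)" and b: "\<beta> \<in> carrier (top_Aut G T)"
    then have "homeomorphic_map T T (\<alpha> \<circ> \<beta>)"
      by (auto simp: top_Aut_def intro: homeomorphic_map_compose)
    then have "homeomorphic_map T T (compose (carrier G) \<alpha> \<beta>)"
      using homeomorphic_map_eq[of T T "\<alpha> \<circ> \<beta>"] by (simp add: compose_def)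
    moreover have "\<alpha> \<otimes>\<^bsub>AutoGroup G\<^esub> \<beta> = compose (carrier G) \<alpha> \<beta>"
      using a b by (simp add: top_Aut_def AutoGroup_def BijGroup_def auto_def)
    moreover have "\<alpha> \<otimes>\<^bsub>AutoGroup G\<^esub> \<beta> \<in> auto G"
      using a b A.m_closed[of \<alpha> \<beta>] by (auto simp: top_Aut_def AutoGroup_def)
    ultimately show "\<alpha> \<otimes>\<^bsub>AutoGroup G\<^esub> \<beta> \<in> carrier (top_Aut G T)"
      by (simp add: top_Aut_def)
  qed
qed

lemma (in topological_group) group_top_Aut: "group (top_Aut G T)"
proof -
  have "top_Aut G T = (AutoGroup G)\<lparr>carrier := carrier (top_Aut G T)\<rparr>"
    by (simp add: top_Aut_def)
  then show ?thesis
    using group.subgroup_imp_group[OF AutoGroup subgroup_top_Aut] by simp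
qed

lemma (in group) subgroup_index_Int_eq_1_iff:
  assumes "subgroup V G" "subgroup W G"
  shows "subgroup_index G V (V \<inter> W) = 1 \<longleftrightarrow> V \<subseteq> W"
proof -
  let ?U = "V \<inter> W"
  have U: "subgroup ?U G" using assms by (rule subgroups_Inter_pair)
  have one: "\<one> \<in> ?U" using U by (rule subgroup.one_closed)
  have Usub: "?U \<subseteq> carrier G" using U by (rule subgroup.subset)
  have eq: "rcosets\<^bsub>G\<lparr>carrier := V\<rparr>\<^esub> ?U = (\<lambda>a. ?U #> a) ` V"
    by (auto simp: RCOSETS_def r_coset_def)
  have U_in: "?U \<in> (\<lambda>a. ?U #> a) ` V"
    using one coset_mult_one[OF Usub] by (metis IntD1 rev_image_eqI)
  show ?thesis
  proof
    assume "subgroup_index G V ?U = 1"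
    then have single: "(\<lambda>a. ?U #> a) ` V = {?U}"
      using U_in unfolding subgroup_index_def eq by (metis card_1_singletonE singletonD)
    show "V \<subseteq> W"
    proof
      fix a assume a: "a \<in> V"
      then have "?U #> a = ?U" using single by blast
      moreover have "a \<in> ?U #> a"
        using a U assms(1) by (meson rcos_self subgroup.mem_carrier)
      ultimately show "a \<in> W" by blast
    qed
  next
    assume "V \<subseteq> W"
    then have "?U = V" by blast
    moreover have "(\<lambda>a. V #> a) ` V = {V}"
      using assms(1) U_in \<open>?U = V\<close> by (auto simp: coset_join2 subgroup.mem_carrier)
    ultimately show "subgroup_index G V ?U = 1"
      unfolding subgroup_index_def eq by simp
  qed
qed

lemma (in topological_group) flat_stabilizer_subset:
  assumes H: "subgroup H (top_Aut G T)"
    and U: "minimizing_for_all G T H U" and V: "minimizing_for_all G T H V"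
    and a: "\<alpha> \<in> H" and fix_U: "\<alpha> ` U = U"
  shows "\<alpha> ` V \<subseteq> V"
proof -
  have sub: "subgroup U G" "subgroup V G"
    using U V by (auto simp: minimizing_for_all_def compact_open_subgroups_def)
  have "\<alpha> \<in> carrier (top_Aut G T)" using H a by (rule subgroup.mem_carrier)
  then have "\<alpha> \<in> hom G G" by (auto simp: top_Aut_def auto_def)
  then interpret \<alpha>: group_hom G G \<alpha> by unfold_locales
  have "subgroup (\<alpha> ` V) G" by (rule \<alpha>.subgroup_img_is_subgroup[OF sub(2)])
  moreover have "aut_scale G T \<alpha> = 1"
    using U a fix_U subgroup_index_Int_eq_1_iff[OF sub(1) sub(1)]
    by (auto simp: minimizing_for_all_def minimizing_def)
  moreover have "subgroup_index G (\<alpha> ` V) (\<alpha> ` V \<inter> V) = aut_scale G T \<alpha>"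
    using V a by (simp add: minimizing_for_all_def minimizing_def)
  ultimately show ?thesis
    using subgroup_index_Int_eq_1_iff[of "\<alpha> ` V" V] sub(2) by simp
qed

lemma (in topological_group) flat_stabilizer_unique:
  assumes H: "subgroup H (top_Aut G T)"
    and U: "minimizing_for_all G T H U" and V: "minimizing_for_all G T H V"
    and a: "\<alpha> \<in> H" and fix_U: "\<alpha> ` U = U"
  shows "\<alpha> ` V = V"
proof
  show "\<alpha> ` V \<subseteq> V" by (rule flat_stabilizer_subset[OF assms])
next
  interpret A: group "top_Aut G T" by (rule group_top_Aut)
  define \<beta> where "\<beta> = inv\<^bsub>top_Aut G T\<^esub> \<alpha>"
  have ac: "\<alpha> \<in> carrier (top_Aut G T)" using H a by (rule subgroup.mem_carrier)
  have b: "\<beta> \<in> H" unfolding \<beta>_def using H a by (rule subgroup.m_inv_closed)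
  have bc: "\<beta> \<in> carrier (top_Aut G T)" using H b by (rule subgroup.mem_carrier)
  have mult: "\<gamma> \<otimes>\<^bsub>top_Aut G T\<^esub> \<gamma>' = compose (carrier G) \<gamma> \<gamma>'"
    if "\<gamma> \<in> carrier (top_Aut G T)" "\<gamma>' \<in> carrier (top_Aut G T)" for \<gamma> \<gamma>'
    using that by (simp add: top_Aut_def AutoGroup_def BijGroup_def auto_def)
  have one: "\<one>\<^bsub>top_Aut G T\<^esub> = (\<lambda>x \<in> carrier G. x)"
    by (simp add: top_Aut_def AutoGroup_def BijGroup_def)
  have ba: "\<beta> (\<alpha> x) = x" if "x \<in> carrier G" for x
  proof -
    have "compose (carrier G) \<beta> \<alpha> = (\<lambda>x \<in> carrier G. x)"
      using mult[OF bc ac] one A.l_inv[OF ac] by (simp only: \<beta>_def)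
    then show ?thesis using that by (metis compose_eq restrict_apply')
  qed
  have ab: "\<alpha> (\<beta> x) = x" if "x \<in> carrier G" for x
  proof -
    have "compose (carrier G) \<alpha> \<beta> = (\<lambda>x \<in> carrier G. x)"
      using mult[OF ac bc] one A.r_inv[OF ac] by (simp only: \<beta>_def)
    then show ?thesis using that by (metis compose_eq restrict_apply')
  qed
  have sub: "U \<subseteq> carrier G" "V \<subseteq> carrier G"
    using U V by (auto simp: minimizing_for_all_def compact_open_subgroups_def
        dest: subgroup.subset)
  have "\<beta> ` (\<alpha> ` U) = U"
  proof -
    have "(\<lambda>x. \<beta> (\<alpha> x)) ` U = (\<lambda>x. x) ` U"
      by (rule image_cong) (use sub(1) ba in auto)
    then show ?thesis by (simp only: image_image image_ident)
  qed
  then have bV: "\<beta> ` V \<subseteq> V"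
    using flat_stabilizer_subset[OF H U V b] fix_U by simp
  show "V \<subseteq> \<alpha> ` V"
  proof
    fix x assume x: "x \<in> V"
    then have "x = \<alpha> (\<beta> x)" using ab sub(2) by auto
    moreover have "\<beta> x \<in> V" using bV x by blast
    ultimately show "x \<in> \<alpha> ` V" by (rule image_eqI)
  qed
qed

lemma (in topological_group) flat_kernel_eq:
  assumes H: "subgroup H (top_Aut G T)" and V: "minimizing_for_all G T H V"
  shows "flat_kernel G T H = {\<alpha>\<in>H. \<alpha> ` V = V}"
proof -
  let ?U = "SOME U. minimizing_for_all G T H U"
  have U: "minimizing_for_all G T H ?U" using V by (rule someI)
  show ?thesis
    unfolding flat_kernel_def Let_def
    using flat_stabilizer_unique[OF H U V] flat_stabilizer_unique[OF H V U] by blast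
qed

lemma ecard_eqpoll: "S \<approx> S' \<Longrightarrow> ecard S = ecard S'"
  unfolding ecard_def by (metis bij_betw_finite bij_betw_same_card eqpoll_def)

lemma free_abelian_rank_eqI:
  fixes Q :: "('q, 'b) monoid_scheme" and B :: "'s set"
  assumes Q: "group Q" and iso: "Q \<cong> free_Abelian_group B"
  shows "free_abelian_rank Q = ecard B"
proof -
  have BQ: "free_Abelian_group B \<cong> Q"
    using group.iso_sym[OF Q] iso by blast
  obtain f where f: "f \<in> iso (free_Abelian_group B) Q"
    using BQ by (auto simp: is_iso_def)
  have "inj_on (\<lambda>b. f (frag_of b)) B"
  proof (rule inj_onI)
    fix b c assume bc: "b \<in> B" "c \<in> B" "f (frag_of b) = f (frag_of c)"
    have "inj_on f (carrier (free_Abelian_group B))"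
      using f by (simp add: iso_def bij_betw_def)
    then have "frag_of b = frag_of c"
      using bc by (meson frag_of_in_free_Abelian_group inj_onD)
    then show "b = c" by (simp only: frag_of_eq)
  qed
  then have "B \<approx> (\<lambda>b. f (frag_of b)) ` B"
    by (simp add: inj_on_image_eqpoll_self eqpoll_sym)
  then have "free_Abelian_group B \<cong> free_Abelian_group ((\<lambda>b. f (frag_of b)) ` B)"
    by (simp add: isomorphic_free_Abelian_groups)
  then have "\<exists>S :: 'q set. Q \<cong> free_Abelian_group S"
    using iso_trans[OF iso] by blast
  moreover have "ecard S = ecard B" if "Q \<cong> free_Abelian_group S" for S :: "'q set"
  proof -
    have "free_Abelian_group B \<cong> free_Abelian_group S"
      using BQ that by (rule iso_trans)
    then show ?thesis
      using isomorphic_free_Abelian_groups ecard_eqpoll by metis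
  qed
  ultimately show ?thesis
    unfolding free_abelian_rank_def
    using someI_ex[of "\<lambda>S :: 'q set. Q \<cong> free_Abelian_group S"] by simp
qed

end

theory Submission
  imports Defs
begin

text \<open>
  Let $O$ be minimizing for a flat group $H$ and write $U_k = \alpha^k(O)$ for $\alpha \in H$. Minimality
  of the index $|\alpha(W) : \alpha(W) \cap W|$ at $W = O$, compared with $W = U_0 \cap \dots \cap U_n$,
  gives the factorization $U_k = (U_i \cap \dots \cap U_k)(U_k \cap \dots \cap U_j)$ for $i \le k \le j$.
  It implies that $a_n = |U_n : U_n \cap U_0|$ satisfies $a_{n+1} \kappa_n = a_1 a_n$ with a
  nondecreasing bounded sequence of integers $\kappa_n$. Hence eventually $a_{n+1} = q a_n$ with a
  natural number $q$, so that $d(O, \alpha^n(O)) = n\ell + O(1)$ where $\ell = 0$ or $\ell \ge \log 2$.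
  If $\ell = 0$, then $Y = U_0 U_N$ is an $\alpha$-invariant compact open set for large $N$, its left
  stabilizer is an $\alpha$-invariant compact open subgroup, and minimality yields $\alpha(O) = O$.

  If $H/H_1$ had rank at least $2$, this would give a function $\ell \ge \log 2$ on $\mathbf{Z}^2 - \{0\}$.
  Applying the four point form of hyperbolicity to multiples of $x$ and $y$ shows
  $\max(\ell(x+y), \ell(x-y)) \ge \ell(x) + \ell(y)$ and
  $\ell(x+y) + \ell(x-y) \le 2 \max(\ell(x), \ell(y))$. So if $\ell(x) \ge \ell(y)$, then
  one of $x \pm y$ has length at most $\ell(x) - \ell(y)$, and Euclid's algorithm descends forever.
\<close>

section \<open>Counting cosets\<close>

context group
begin

text \<open>For subgroups this is the index |Y : Y \<inter> K|, with no need for \<open>K\<close> to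
  lie in \<open>Y\<close>; moreover \<open>Y\<close> may be a mere product set. As
  \<open>card\<close> is 0 on infinite sets, finiteness of the set of cosets is tracked
  separately.\<close>

definition coset_count :: "'a set \<Rightarrow> 'a set \<Rightarrow> nat" where
  "coset_count K Y = card ((\<lambda>y. K #> y) ` Y)"

lemma r_coset_eq_iff:
  assumes "subgroup K G" "x \<in> carrier G" "y \<in> carrier G"
  shows "K #> x = K #> y \<longleftrightarrow> x \<otimes> inv y \<in> K"
proof -
  have "K #> x = K #> y \<longleftrightarrow> x \<in> K #> y"
    using assms by (metis repr_independence rcos_self)
  also have "\<dots> \<longleftrightarrow> x \<otimes> inv y \<in> K"
    using assms subgroup.rcos_module[OF assms(1) is_group] by blast
  finally show ?thesis .
qed

lemma r_coset_mult_subgroup: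
  assumes "subgroup K G" "x \<in> K" "y \<in> carrier G"
  shows "K #> (x \<otimes> y) = K #> y"
  using assms by (metis coset_join2 coset_mult_assoc subgroup.mem_carrier subgroup.subset)

lemma r_coset_Int_eq_iff:
  assumes "subgroup A G" "subgroup B G" "x \<in> A" "y \<in> A"
  shows "(A \<inter> B) #> x = (A \<inter> B) #> y \<longleftrightarrow> B #> x = B #> y"
proof -
  have "x \<in> carrier G" "y \<in> carrier G" "x \<otimes> inv y \<in> A"
    using assms by (auto dest: subgroup.mem_carrier intro: subgroup.m_closed subgroup.m_inv_closed)
  then show ?thesis
    using assms by (auto simp: r_coset_eq_iff subgroups_Inter_pair)
qed

text \<open>For x and y in \<open>A\<close> the quotient \<open>x \<otimes> inv y\<close> lies in
  \<open>A\<close> anyway, so cosets of \<open>B\<close> and of \<open>A \<inter> B\<close> separate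
  the same elements of \<open>A\<close>. A bijection is stated, not an equation of cardinalities,
  because it also transfers finiteness.\<close>

lemma bij_betw_Int_cosets:
  assumes A: "subgroup A G" and B: "subgroup B G"
  shows "\<exists>h. bij_betw h ((\<lambda>y. (A \<inter> B) #> y) ` A) ((\<lambda>y. B #> y) ` A)"
proof -
  let ?f = "\<lambda>y. (A \<inter> B) #> y"
  note eq = r_coset_Int_eq_iff[OF A B]
  have inv: "inv_into A ?f (?f x) \<in> A \<and> B #> inv_into A ?f (?f x) = B #> x" if x: "x \<in> A" for x
  proof -
    have "inv_into A ?f (?f x) \<in> A" "?f (inv_into A ?f (?f x)) = ?f x"
      using x by (auto intro!: inv_into_into f_inv_into_f)
    then show ?thesis using eq x by blast
  qed
  have "bij_betw (\<lambda>z. B #> inv_into A ?f z) (?f ` A) ((\<lambda>y. B #> y) ` A)"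
    unfolding bij_betw_def
  proof
    show "inj_on (\<lambda>z. B #> inv_into A ?f z) (?f ` A)"
      by (rule inj_onI, elim imageE, hypsubst) (simp add: inv eq)
    show "(\<lambda>z. B #> inv_into A ?f z) ` ?f ` A = (\<lambda>y. B #> y) ` A"
      unfolding image_image using inv by (intro image_cong) auto
  qed
  then show ?thesis by blast
qed

lemma coset_count_Int:
  assumes "subgroup A G" "subgroup B G"
  shows "coset_count (A \<inter> B) A = coset_count B A"
  using bij_betw_Int_cosets[OF assms] unfolding coset_count_def by (auto dest: bij_betw_same_card)

lemma subgroup_index_eq_coset_count:
  assumes "subgroup A G" "subgroup B G"
  shows "subgroup_index G A (A \<inter> B) = coset_count B A"
    and "subgroup_index G A (B \<inter> A) = coset_count B A"
proof -
  have "rcosets\<^bsub>G\<lparr>carrier := A\<rparr>\<^esub> (A \<inter> B) = (\<lambda>y. (A \<inter> B) #> y) ` A"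
    by (auto simp: RCOSETS_def r_coset_def)
  then show "subgroup_index G A (A \<inter> B) = coset_count B A"
    using coset_count_Int[OF assms] by (simp add: subgroup_index_def coset_count_def)
  then show "subgroup_index G A (B \<inter> A) = coset_count B A"
    by (simp add: Int_commute)
qed

text \<open>Stability under \<open>L\<close> makes \<open>Y\<close> a union of
  \<open>L\<close>-cosets \<open>P\<close>. With a chosen representative \<open>r P\<close> of each,
  every \<open>K\<close>-coset in \<open>Y\<close> is \<open>K #> (l \<otimes> r P)\<close> for
  exactly one \<open>P\<close> and one coset \<open>K #> l\<close> in \<open>L\<close>.\<close>

lemma bij_betw_cosets_refine:
  assumes K: "subgroup K G" and L: "subgroup L G" and KL: "K \<subseteq> L"
    and Y: "Y \<subseteq> carrier G" and LY: "\<And>l y. l \<in> L \<Longrightarrow> y \<in> Y \<Longrightarrow> l \<otimes> y \<in> Y"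
  shows "\<exists>h. bij_betw h (((\<lambda>y. L #> y) ` Y) \<times> ((\<lambda>l. K #> l) ` L)) ((\<lambda>y. K #> y) ` Y)"
proof -
  define r where "r P = (SOME y. y \<in> Y \<and> P = L #> y)" for P
  have r: "r P \<in> Y \<and> P = L #> r P" if "P \<in> (\<lambda>y. L #> y) ` Y" for P
    unfolding r_def by (rule someI_ex) (use that in blast)
  have Kc: "K \<subseteq> carrier G" and Lc: "L \<subseteq> carrier G"
    using K L by (auto dest: subgroup.subset)
  let ?X = "((\<lambda>y. L #> y) ` Y) \<times> ((\<lambda>l. K #> l) ` L)"
  have eq: "Q #> r P = K #> (l \<otimes> r P)" if "P \<in> (\<lambda>y. L #> y) ` Y" "l \<in> L" "Q = K #> l" for P Q l
    using that(2,3) conjunct1[OF r[OF that(1)]] Y Lc coset_mult_assoc[OF Kc, of l "r P"] by auto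
  have "bij_betw (\<lambda>(P, Q). Q #> r P) ?X ((\<lambda>y. K #> y) ` Y)"
    unfolding bij_betw_def
  proof
    show "inj_on (\<lambda>(P, Q). Q #> r P) ?X"
    proof (rule inj_onI, clarsimp)
      fix y y' l l'
      assume *: "y \<in> Y" "y' \<in> Y" "l \<in> L" "l' \<in> L"
        "K #> l #> r (L #> y) = K #> l' #> r (L #> y')"
      let ?a = "r (L #> y)" and ?b = "r (L #> y')"
      have ab: "?a \<in> Y" "?b \<in> Y" "L #> y = L #> ?a" "L #> y' = L #> ?b"
        using r[of "L #> y"] r[of "L #> y'"] * by blast+
      have c: "?a \<in> carrier G" "?b \<in> carrier G" "l \<in> carrier G" "l' \<in> carrier G"
        using ab * Y Lc by auto
      have "K #> (l \<otimes> ?a) = K #> (l' \<otimes> ?b)"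
        using * c Kc by (simp add: coset_mult_assoc)
      then have "(l \<otimes> ?a) \<otimes> inv (l' \<otimes> ?b) \<in> L"
        using K c KL by (subst (asm) r_coset_eq_iff) auto
      then have "L #> (l \<otimes> ?a) = L #> (l' \<otimes> ?b)"
        using L c by (subst r_coset_eq_iff) auto
      then have Leq: "L #> y = L #> y'"
        using ab c * L by (simp add: r_coset_mult_subgroup)
      \<comment> \<open>Equal \<open>L\<close>-cosets have the same chosen representative, which
        cancels.\<close>
      then have "K #> l #> ?a #> inv ?a = K #> l' #> ?a #> inv ?a"
        using *(5) by simp
      then have "K #> l = K #> l'"
        using c Kc by (simp add: coset_mult_assoc m_assoc)
      with Leq show "L #> y = L #> y' \<and> K #> l = K #> l'" by blast
    qed
    show "(\<lambda>(P, Q). Q #> r P) ` ?X = (\<lambda>y. K #> y) ` Y"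
    proof (intro equalityI subsetI)
      fix Z assume "Z \<in> (\<lambda>(P, Q). Q #> r P) ` ?X"
      then obtain y l where "y \<in> Y" "l \<in> L" "Z = K #> l #> r (L #> y)" by auto
      then have "Z = K #> (l \<otimes> r (L #> y))" "l \<otimes> r (L #> y) \<in> Y"
        using eq[of "L #> y" l "K #> l"] LY conjunct1[OF r[of "L #> y"]] by auto
      then show "Z \<in> (\<lambda>y. K #> y) ` Y" by blast
    next
      fix Z assume "Z \<in> (\<lambda>y. K #> y) ` Y"
      then obtain y where y: "y \<in> Y" "Z = K #> y" by blast
      let ?a = "r (L #> y)"
      have a: "?a \<in> Y" "L #> y = L #> ?a" using r[of "L #> y"] y by blast+
      have c: "?a \<in> carrier G" "y \<in> carrier G" using a y Y by auto
      have l: "y \<otimes> inv ?a \<in> L" using r_coset_eq_iff[OF L] a c by blast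
      have "K #> (y \<otimes> inv ?a) #> ?a = Z"
        using c y Kc by (simp add: coset_mult_assoc m_assoc)
      then have "(\<lambda>(P, Q). Q #> r P) (L #> y, K #> (y \<otimes> inv ?a)) = Z" by simp
      moreover have "(L #> y, K #> (y \<otimes> inv ?a)) \<in> ?X" using l y by blast
      ultimately show "Z \<in> (\<lambda>(P, Q). Q #> r P) ` ?X" by (rule image_eqI[OF sym])
    qed
  qed
  then show ?thesis by blast
qed

lemma coset_count_refine:
  assumes K: "subgroup K G" and L: "subgroup L G" and KL: "K \<subseteq> L"
    and Y: "Y \<subseteq> carrier G" and LY: "\<And>l y. l \<in> L \<Longrightarrow> y \<in> Y \<Longrightarrow> l \<otimes> y \<in> Y"
  shows "coset_count K Y = coset_count L Y * coset_count K L"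
  using bij_betw_cosets_refine[OF assms] unfolding coset_count_def
  by (metis bij_betw_same_card card_cartesian_product)

lemma finite_cosets_refine:
  assumes K: "subgroup K G" and L: "subgroup L G" and KL: "K \<subseteq> L"
    and Y: "Y \<subseteq> carrier G" and LY: "\<And>l y. l \<in> L \<Longrightarrow> y \<in> Y \<Longrightarrow> l \<otimes> y \<in> Y"
    and "finite ((\<lambda>y. L #> y) ` Y)" "finite ((\<lambda>l. K #> l) ` L)"
  shows "finite ((\<lambda>y. K #> y) ` Y)"
  using bij_betw_cosets_refine[OF K L KL Y LY] assms(6,7) by (metis bij_betw_finite finite_cartesian_product)

lemma coset_count_mono:
  assumes "Y \<subseteq> Z" "finite ((\<lambda>y. K #> y) ` Z)"
  shows "coset_count K Y \<le> coset_count K Z"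
  unfolding coset_count_def using assms by (intro card_mono image_mono)

text \<open>Left multiplication by \<open>L\<close> sends \<open>K #> y\<close> to
  \<open>L #> y\<close>, so the \<open>K\<close>-cosets map onto the
  \<open>L\<close>-cosets.\<close>

lemma coset_count_antimono:
  assumes K: "subgroup K G" and L: "subgroup L G" and KL: "K \<subseteq> L" and Y: "Y \<subseteq> carrier G"
    and fin: "finite ((\<lambda>y. K #> y) ` Y)"
  shows "coset_count L Y \<le> coset_count K Y"
proof -
  have "L #> y = (\<Union>k\<in>L. \<Union>x\<in>K #> y. {k \<otimes> x})" if "y \<in> Y" for y
  proof (intro equalityI subsetI)
    fix x assume "x \<in> L #> y"
    then obtain l where "l \<in> L" "x = l \<otimes> y" by (auto simp: r_coset_def)
    moreover have "y \<in> K #> y" using that Y K rcos_self by blast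
    ultimately show "x \<in> (\<Union>k\<in>L. \<Union>x\<in>K #> y. {k \<otimes> x})" by blast
  next
    fix x assume "x \<in> (\<Union>k\<in>L. \<Union>x\<in>K #> y. {k \<otimes> x})"
    then obtain l k where lk: "l \<in> L" "k \<in> K" "x = l \<otimes> (k \<otimes> y)" by (auto simp: r_coset_def)
    then have "x = (l \<otimes> k) \<otimes> y"
      using that Y K L by (metis m_assoc subgroup.mem_carrier subsetD)
    moreover have "l \<otimes> k \<in> L" using lk KL L by (auto intro: subgroup.m_closed)
    ultimately show "x \<in> L #> y" by (auto simp: r_coset_def)
  qed
  then have "(\<lambda>y. L #> y) ` Y = (\<lambda>P. \<Union>k\<in>L. \<Union>x\<in>P. {k \<otimes> x}) ` (\<lambda>y. K #> y) ` Y"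
    by (auto simp: image_image)
  then show ?thesis unfolding coset_count_def using fin card_image_le by metis
qed

lemma coset_count_pos:
  assumes "finite ((\<lambda>y. K #> y) ` Y)" "Y \<noteq> {}"
  shows "coset_count K Y > 0"
  using assms by (simp add: coset_count_def card_gt_0_iff)

text \<open>The product set \<open>Y = B A\<close> contains \<open>A\<close>, is stable under
  \<open>B\<close> and meets the same \<open>B\<close>-cosets as \<open>A\<close>. With
  \<open>K = B \<inter> C\<close> the count for \<open>C\<close> and \<open>A\<close> is at most
  that for \<open>K\<close> and \<open>Y\<close>, which factors through \<open>B\<close> into the
  right-hand side.\<close>

lemma coset_count_triangle:
  assumes A: "subgroup A G" and B: "subgroup B G" and C: "subgroup C G"
    and AB: "finite ((\<lambda>y. B #> y) ` A)" and BC: "finite ((\<lambda>y. C #> y) ` B)"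
  shows "coset_count C A \<le> coset_count B A * coset_count C B"
proof -
  define Y where "Y = {b \<otimes> a | a b. a \<in> A \<and> b \<in> B}"
  have c: "A \<subseteq> carrier G" "B \<subseteq> carrier G"
    using A B by (auto dest: subgroup.subset)
  have Y: "Y \<subseteq> carrier G" using c by (auto simp: Y_def)
  have AY: "A \<subseteq> Y"
  proof
    fix a assume "a \<in> A"
    moreover have "\<one> \<in> B" by (rule subgroup.one_closed[OF B])
    moreover have "a = \<one> \<otimes> a" using \<open>a \<in> A\<close> c by auto
    ultimately show "a \<in> Y" unfolding Y_def by blast
  qed
  have BY: "b \<otimes> y \<in> Y" if b: "b \<in> B" and y: "y \<in> Y" for b y
  proof -
    obtain a b' where ab: "a \<in> A" "b' \<in> B" "y = b' \<otimes> a" using y by (auto simp: Y_def)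
    then have "b \<otimes> y = (b \<otimes> b') \<otimes> a" using c b by (metis m_assoc subsetD)
    moreover have "b \<otimes> b' \<in> B" using B b ab by (auto intro: subgroup.m_closed)
    ultimately show ?thesis using ab by (auto simp: Y_def)
  qed
  have "B #> (b \<otimes> a) = B #> a" if "a \<in> A" "b \<in> B" for a b
    using that r_coset_mult_subgroup[OF B] c by blast
  then have cosY: "(\<lambda>y. B #> y) ` Y = (\<lambda>y. B #> y) ` A"
    using AY by (auto simp: Y_def)
  let ?K = "B \<inter> C"
  have K: "subgroup ?K G" using B C by (rule subgroups_Inter_pair)
  have finKB: "finite ((\<lambda>y. ?K #> y) ` B)"
    using bij_betw_Int_cosets[OF B C] BC by (auto dest: bij_betw_finite)
  have finKY: "finite ((\<lambda>y. ?K #> y) ` Y)"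
    by (rule finite_cosets_refine[OF K B _ Y BY _ finKB]) (use AB cosY in auto)
  then have "finite ((\<lambda>y. ?K #> y) ` A)"
    by (rule rev_finite_subset) (use AY in auto)
  then have "coset_count C A \<le> coset_count ?K A"
    using coset_count_antimono[OF K C _ c(1)] by blast
  also have "\<dots> \<le> coset_count ?K Y" by (rule coset_count_mono[OF AY finKY])
  also have "\<dots> = coset_count B Y * coset_count ?K B"
    by (rule coset_count_refine[OF K B _ Y BY]) auto
  also have "\<dots> = coset_count B A * coset_count C B"
    using coset_count_Int[OF B C] cosY by (simp add: coset_count_def)
  finally show ?thesis .
qed

lemma coset_count_eq_1_iff:
  assumes "subgroup A G" "subgroup B G"
  shows "coset_count B A = 1 \<longleftrightarrow> A \<subseteq> B"
  using subgroup_index_Int_eq_1_iff[OF assms] subgroup_index_eq_coset_count(1)[OF assms] by simp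

end

section \<open>Compact open subgroups and the metric on them\<close>

context topological_group
begin

lemma openin_r_coset:
  assumes B: "openin T B" and a: "a \<in> carrier G"
  shows "openin T (B #> a)"
proof -
  have Bc: "B \<subseteq> carrier G" using openin_subset[OF B] by simp
  have "continuous_map T (prod_topology T T) (\<lambda>x. (x, inv a))"
    using a by (intro continuous_map_pairedI) auto
  then have cont: "continuous_map T T (\<lambda>x. x \<otimes> inv a)"
    using continuous_map_compose[OF _ continuous_mult] by (fastforce simp: o_def)
  have "B #> a = {x \<in> topspace T. x \<otimes> inv a \<in> B}"
  proof (intro equalityI subsetI)
    fix x assume "x \<in> B #> a"
    then obtain b where "b \<in> B" "x = b \<otimes> a" by (auto simp: r_coset_def)
    then show "x \<in> {x \<in> topspace T. x \<otimes> inv a \<in> B}" using a Bc by (auto simp: m_assoc)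
  next
    fix x assume "x \<in> {x \<in> topspace T. x \<otimes> inv a \<in> B}"
    then have "x \<otimes> inv a \<in> B" "x = (x \<otimes> inv a) \<otimes> a" using a by (auto simp: m_assoc)
    then show "x \<in> B #> a" unfolding r_coset_def by blast
  qed
  then show ?thesis using openin_continuous_map_preimage[OF cont B] by simp
qed

lemma compactin_r_coset:
  assumes B: "compactin T B" and a: "a \<in> carrier G"
  shows "compactin T (B #> a)"
proof -
  have "continuous_map T (prod_topology T T) (\<lambda>x. (x, a))"
    using a by (intro continuous_map_pairedI) auto
  then have "continuous_map T T (\<lambda>x. x \<otimes> a)"
    using continuous_map_compose[OF _ continuous_mult] by (fastforce simp: o_def)
  then have "compactin T ((\<lambda>x. x \<otimes> a) ` B)" by (rule image_compactin[OF B])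
  moreover have "(\<lambda>x. x \<otimes> a) ` B = B #> a" by (auto simp: r_coset_def)
  ultimately show ?thesis by simp
qed

text \<open>The complement is the union of the open cosets of the elements outside \<open>B\<close>.
  Closedness yields compactness of the intersection of two compact open subgroups.\<close>

lemma closedin_open_subgroup:
  assumes B: "subgroup B G" "openin T B"
  shows "closedin T B"
proof -
  have Bc: "B \<subseteq> carrier G" using B by (simp add: subgroup.subset)
  have "carrier G - B = (\<Union>a\<in>carrier G - B. B #> a)"
  proof (intro equalityI subsetI)
    fix x assume "x \<in> carrier G - B"
    then show "x \<in> (\<Union>a\<in>carrier G - B. B #> a)" using rcos_self B by blast
  next
    fix x assume "x \<in> (\<Union>a\<in>carrier G - B. B #> a)"
    then obtain a b where ab: "a \<in> carrier G" "a \<notin> B" "b \<in> B" "x = b \<otimes> a"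
      by (auto simp: r_coset_def)
    then have "a = inv b \<otimes> x" using Bc by (metis inv_solve_left m_closed subsetD)
    then have "x \<notin> B" using ab B by (metis subgroup.m_closed subgroup.m_inv_closed)
    then show "x \<in> carrier G - B" using ab Bc by auto
  qed
  moreover have "openin T (\<Union>a\<in>carrier G - B. B #> a)"
    by (rule openin_Union) (auto intro: openin_r_coset B)
  ultimately show ?thesis using Bc by (simp add: closedin_def)
qed

text \<open>The open cosets meeting \<open>A\<close> cover it and are pairwise disjoint, so a finite
  subcover must already contain all of them.\<close>

lemma finite_cosets_compact:
  assumes A: "compactin T A" and B: "subgroup B G" "openin T B"
  shows "finite ((\<lambda>y. B #> y) ` A)"
proof -
  have Ac: "A \<subseteq> carrier G" using compactin_subset_topspace[OF A] by simp
  obtain \<F> where F: "finite \<F>" "\<F> \<subseteq> (\<lambda>y. B #> y) ` A" "A \<subseteq> \<Union>\<F>"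
  proof -
    have "A \<subseteq> \<Union>((\<lambda>y. B #> y) ` A)" using rcos_self[OF _ B(1)] Ac by blast
    moreover have "\<forall>U\<in>(\<lambda>y. B #> y) ` A. openin T U" using openin_r_coset B Ac by blast
    ultimately show ?thesis using A that unfolding compactin_def by meson
  qed
  have "(\<lambda>y. B #> y) ` A \<subseteq> \<F>"
  proof
    fix Z assume "Z \<in> (\<lambda>y. B #> y) ` A"
    then obtain x where x: "x \<in> A" "Z = B #> x" by blast
    then obtain P where P: "P \<in> \<F>" "x \<in> P" using F(3) by (meson UnionE subsetD)
    moreover obtain y where y: "y \<in> A" "P = B #> y" using F(2) P(1) by (meson imageE subsetD)
    ultimately have "P = B #> x"
      using repr_independence[of x B y] B(1) Ac by (simp add: subset_iff)
    then show "Z \<in> \<F>" using x P by simp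
  qed
  then show ?thesis using F finite_subset by blast
qed

lemma compact_open_subgroupsD:
  assumes "V \<in> compact_open_subgroups G T"
  shows "subgroup V G" "compactin T V" "openin T V" "V \<subseteq> carrier G"
  using assms by (auto simp: compact_open_subgroups_def dest: subgroup.subset)

lemma finite_cosets:
  assumes "A \<in> compact_open_subgroups G T" "B \<in> compact_open_subgroups G T"
  shows "finite ((\<lambda>y. B #> y) ` A)"
  using assms by (intro finite_cosets_compact) (auto dest: compact_open_subgroupsD)

lemma coset_count_compact_open_pos:
  assumes "A \<in> compact_open_subgroups G T" "B \<in> compact_open_subgroups G T"
  shows "coset_count B A > 0"
proof (rule coset_count_pos)
  show "A \<noteq> {}" using assms(1) by (auto dest!: compact_open_subgroupsD(1) subgroup.one_closed)
qed (rule finite_cosets[OF assms])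

lemma compact_open_subgroups_Int:
  assumes "A \<in> compact_open_subgroups G T" "B \<in> compact_open_subgroups G T"
  shows "A \<inter> B \<in> compact_open_subgroups G T"
  using assms compact_Int_closedin[of T A B] closedin_open_subgroup[of B]
  by (auto simp: compact_open_subgroups_def intro: subgroups_Inter_pair)

text \<open>\<open>M\<close> is a union of finitely many translates of \<open>U\<close>, each
  compact and open. This is how the stabilizer of a product set will be recognized as compact and
  open.\<close>

lemma compact_open_subgroups_superset:
  assumes U: "U \<in> compact_open_subgroups G T" and M: "subgroup M G" and UM: "U \<subseteq> M"
    and fin: "finite ((\<lambda>y. U #> y) ` M)"
  shows "M \<in> compact_open_subgroups G T"
proof -
  note U' = compact_open_subgroupsD[OF U]
  have Mc: "M \<subseteq> carrier G" using M by (rule subgroup.subset)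
  have eq: "M = \<Union>((\<lambda>y. U #> y) ` M)"
  proof (intro equalityI subsetI)
    fix x assume "x \<in> M"
    then show "x \<in> \<Union>((\<lambda>y. U #> y) ` M)" using rcos_self[OF _ U'(1)] Mc by blast
  next
    fix x assume "x \<in> \<Union>((\<lambda>y. U #> y) ` M)"
    then show "x \<in> M" using UM M by (auto simp: r_coset_def intro: subgroup.m_closed)
  qed
  have "openin T (\<Union>((\<lambda>y. U #> y) ` M))"
    using openin_r_coset U' Mc by (intro openin_Union) blast
  moreover have "compactin T (\<Union>((\<lambda>y. U #> y) ` M))"
    using compactin_r_coset U' Mc fin by (intro compactin_Union) blast+
  ultimately show ?thesis using eq M by (simp add: compact_open_subgroups_def)
qed

lemma subgroup_dist_eq:
  assumes "A \<in> compact_open_subgroups G T" "B \<in> compact_open_subgroups G T"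
  shows "subgroup_dist G A B = ln (coset_count B A) + ln (coset_count A B)"
  using assms coset_count_compact_open_pos
  by (simp add: subgroup_dist_def subgroup_index_eq_coset_count compact_open_subgroupsD ln_mult)

lemma subgroup_dist_sym: "subgroup_dist G A B = subgroup_dist G B A"
  by (simp add: subgroup_dist_def Int_commute mult.commute)

text \<open>Each of the two logarithms of indices satisfies a triangle inequality of its own, by
  submultiplicativity; the second is used with \<open>A\<close> and \<open>C\<close>
  exchanged.\<close>

lemma subgroup_dist_triangle:
  assumes "A \<in> compact_open_subgroups G T" "B \<in> compact_open_subgroups G T"
    "C \<in> compact_open_subgroups G T"
  shows "subgroup_dist G A C \<le> subgroup_dist G A B + subgroup_dist G B C"
proof -
  have *: "ln (real (coset_count Z X)) \<le> ln (real (coset_count Y X)) + ln (real (coset_count Z Y))"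
    if "X \<in> compact_open_subgroups G T" "Y \<in> compact_open_subgroups G T"
      "Z \<in> compact_open_subgroups G T" for X Y Z
  proof -
    have "real (coset_count Z X) \<le> real (coset_count Y X) * real (coset_count Z Y)"
      using coset_count_triangle that finite_cosets compact_open_subgroupsD(1)
      by (metis of_nat_le_iff of_nat_mult)
    then have "ln (real (coset_count Z X)) \<le> ln (real (coset_count Y X) * real (coset_count Z Y))"
      using that coset_count_compact_open_pos by (subst ln_le_cancel_iff) auto
    then show ?thesis using that coset_count_compact_open_pos by (simp add: ln_mult)
  qed
  show ?thesis using *[of A B C] *[of C B A] assms by (simp add: subgroup_dist_eq)
qed

end

section \<open>Orbits of a minimizing subgroup\<close>

text \<open>A bounded nondecreasing \<open>k\<close> is constant from some \<open>N\<close> on, so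
  the ratio of successive terms is then m / k N. All terms are integers, so arbitrarily high powers
  of the reduced denominator divide \<open>a N\<close>; hence this denominator is 1.\<close>

lemma eventually_geometric:
  fixes a k :: "nat \<Rightarrow> nat" and m :: nat
  assumes pos: "\<And>n. a n > 0" "m > 0"
    and rec: "\<And>n. a (Suc n) * k n = m * a n"
    and mono: "\<And>n. k n \<le> k (Suc n)" and bound: "\<And>n. k n \<le> m"
  shows "\<exists>N q. q > 0 \<and> (\<forall>n. a (N + n) = q ^ n * a N)"
proof -
  have fin: "finite (range k)" by (rule finite_subset[of _ "{..m}"]) (use bound in auto)
  then obtain N where N: "Max (range k) = k N" using Max_in[OF fin] by blast
  have const: "k n = k N" if "n \<ge> N" for n
    using lift_Suc_mono_le[of k N n] mono that Max_ge[OF fin, of "k n"] N by force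
  let ?c = "k N"
  have c0: "?c > 0" using rec[of N] pos by (metis gr0I mult_0_right nat_0_less_mult_iff)
  have pow: "a (N + j) * ?c ^ j = m ^ j * a N" for j
  proof (induction j)
    case (Suc j)
    have "a (N + Suc j) * ?c ^ Suc j = (a (Suc (N + j)) * k (N + j)) * ?c ^ j"
      using const[of "N + j"] by simp
    also have "\<dots> = m * (a (N + j) * ?c ^ j)" using rec by (simp add: mult.assoc)
    finally show ?case using Suc by simp
  qed simp
  \<comment> \<open>\<open>c\<close> and \<open>m'\<close> are the denominator and numerator of m /
    k N in lowest terms, while \<open>?c\<close> remains the unreduced \<open>k N\<close>.\<close>
  define g where "g = gcd ?c m"
  define c m' where "c = ?c div g" and "m' = m div g"
  have g0: "g > 0" using c0 by (simp add: g_def)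
  have cg: "?c = c * g" "m = m' * g" by (simp_all add: c_def m'_def g_def)
  have cop: "coprime c m'" unfolding c_def m'_def g_def using c0 by (intro div_gcd_coprime) simp
  have "c ^ j \<le> a N" for j
  proof -
    have "(a (N + j) * c ^ j) * g ^ j = (m' ^ j * a N) * g ^ j"
      using pow[of j] cg by (metis mult.assoc mult.commute power_mult_distrib)
    then have "a (N + j) * c ^ j = m' ^ j * a N" using g0 by simp
    then have "c ^ j dvd m' ^ j * a N" by (metis dvd_triv_right)
    then have "c ^ j dvd a N" using cop by (simp add: coprime_dvd_mult_right_iff)
    then show ?thesis using pos by (simp add: dvd_imp_le)
  qed
  \<comment> \<open>With \<open>c \<ge> 2\<close> the bound on \<open>c ^ j\<close> would fail at j
    = \<open>a N\<close>.\<close>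
  moreover have "a N < 2 ^ a N" by (rule less_exp)
  ultimately have "\<not> c \<ge> 2"
    by (metis (no_types, lifting) leD order_trans power_mono zero_le)
  moreover have "c \<noteq> 0" using cg(1) c0 by (metis mult_0 less_numeral_extra(3))
  ultimately have "c = 1" by simp
  then have m: "m = m' * ?c" using cg by (metis mult_1)
  then have "m' > 0" using pos by (metis mult_0 gr0I less_numeral_extra(3))
  moreover have "a (N + n) = m' ^ n * a N" for n
  proof -
    have "a (N + n) * ?c ^ n = (m' ^ n * a N) * ?c ^ n"
      using pow[of n] m by (metis mult.assoc mult.commute power_mult_distrib)
    then show ?thesis using c0 by simp
  qed
  ultimately show ?thesis by blast
qed

section \<open>The action of bicontinuous automorphisms on compact open subgroups\<close>

sublocale topological_group \<subseteq> Aut: group "top_Aut G T"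
  by (rule group_top_Aut)

context topological_group
begin

lemma top_Aut_mult:
  assumes "\<alpha> \<in> carrier (top_Aut G T)" "\<beta> \<in> carrier (top_Aut G T)"
  shows "\<alpha> \<otimes>\<^bsub>top_Aut G T\<^esub> \<beta> = compose (carrier G) \<alpha> \<beta>"
  using assms by (simp add: top_Aut_def AutoGroup_def BijGroup_def auto_def)

lemma top_Aut_one: "\<one>\<^bsub>top_Aut G T\<^esub> = (\<lambda>x \<in> carrier G. x)"
  by (simp add: top_Aut_def AutoGroup_def BijGroup_def)

text \<open>The group product is composition cut off outside the carrier, so it acts as composition
  on subsets of the carrier.\<close>

lemma top_Aut_image_mult:
  assumes "\<alpha> \<in> carrier (top_Aut G T)" "\<beta> \<in> carrier (top_Aut G T)" "X \<subseteq> carrier G"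
  shows "(\<alpha> \<otimes>\<^bsub>top_Aut G T\<^esub> \<beta>) ` X = \<alpha> ` \<beta> ` X"
  using assms by (auto simp: top_Aut_mult compose_def subset_iff image_image intro!: image_cong)

lemma top_Aut_image_one:
  assumes "X \<subseteq> carrier G"
  shows "\<one>\<^bsub>top_Aut G T\<^esub> ` X = X"
  using assms by (auto simp: top_Aut_one subset_iff image_iff)

lemma top_AutD:
  assumes "\<alpha> \<in> carrier (top_Aut G T)"
  shows "group_hom G G \<alpha>" "inj_on \<alpha> (carrier G)" "\<alpha> ` carrier G = carrier G"
    "homeomorphic_map T T \<alpha>"
  using assms
  by (auto simp: top_Aut_def auto_def Bij_def bij_betw_def group_hom_def group_hom_axioms_def)

lemma top_Aut_image_inv:
  assumes "\<alpha> \<in> carrier (top_Aut G T)" "X \<subseteq> carrier G"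
  shows "(inv\<^bsub>top_Aut G T\<^esub> \<alpha>) ` \<alpha> ` X = X" "\<alpha> ` (inv\<^bsub>top_Aut G T\<^esub> \<alpha>) ` X = X"
  using assms by (simp_all add: top_Aut_image_mult[symmetric] top_Aut_image_one)

lemma top_Aut_image_compact_open:
  assumes a: "\<alpha> \<in> carrier (top_Aut G T)" and V: "V \<in> compact_open_subgroups G T"
  shows "\<alpha> ` V \<in> compact_open_subgroups G T"
proof -
  interpret \<alpha>: group_hom G G \<alpha> by (rule top_AutD(1)[OF a])
  note hom = top_AutD(4)[OF a]
  note V' = compact_open_subgroupsD[OF V]
  have top: "V \<subseteq> topspace T" using V'(4) by simp
  have "subgroup (\<alpha> ` V) G" by (rule \<alpha>.subgroup_img_is_subgroup[OF V'(1)])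
  moreover have "compactin T (\<alpha> ` V)"
    using homeomorphic_map_compactness[OF hom top] V'(2) by simp
  moreover have "openin T (\<alpha> ` V)"
    using homeomorphic_map_openness[OF hom top] V'(3) by simp
  ultimately show ?thesis by (simp add: compact_open_subgroups_def)
qed

lemma top_Aut_image_r_coset:
  assumes a: "\<alpha> \<in> carrier (top_Aut G T)" and K: "K \<subseteq> carrier G" and y: "y \<in> carrier G"
  shows "\<alpha> ` (K #> y) = \<alpha> ` K #> \<alpha> y"
proof -
  interpret \<alpha>: group_hom G G \<alpha> by (rule top_AutD(1)[OF a])
  show ?thesis using K y unfolding r_coset_def by (force simp: subset_iff image_iff)
qed

lemma coset_count_image:
  assumes a: "\<alpha> \<in> carrier (top_Aut G T)" and K: "K \<subseteq> carrier G" and Y: "Y \<subseteq> carrier G"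
  shows "coset_count (\<alpha> ` K) (\<alpha> ` Y) = coset_count K Y"
proof -
  have "(\<lambda>y. \<alpha> ` K #> y) ` \<alpha> ` Y = (`) \<alpha> ` (\<lambda>y. K #> y) ` Y"
    unfolding image_image using top_Aut_image_r_coset[OF a K] Y by (intro image_cong) auto
  moreover have "inj_on ((`) \<alpha>) ((\<lambda>y. K #> y) ` Y)"
  proof (rule inj_onI)
    fix P Q assume "P \<in> (\<lambda>y. K #> y) ` Y" "Q \<in> (\<lambda>y. K #> y) ` Y" "\<alpha> ` P = \<alpha> ` Q"
    then show "P = Q"
      using inj_on_image_eq_iff[OF top_AutD(2)[OF a], of P Q] r_coset_subset_G[OF K] Y by blast
  qed
  ultimately show ?thesis by (simp add: coset_count_def card_image)
qed

lemma subgroup_dist_image: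
  assumes "\<alpha> \<in> carrier (top_Aut G T)"
    and "A \<in> compact_open_subgroups G T" "B \<in> compact_open_subgroups G T"
  shows "subgroup_dist G (\<alpha> ` A) (\<alpha> ` B) = subgroup_dist G A B"
  using assms by (simp add: subgroup_dist_eq top_Aut_image_compact_open coset_count_image
      compact_open_subgroupsD)

end

text \<open>\<open>V\<close> is minimizing for \<alpha> and for its inverse. The condition on the
  inverse is written after applying \<alpha>: |V : V \<inter> \<alpha>(V)| equals the index of V
  \<inter> \<alpha>^-1(V) in \<alpha>^-1(V).\<close>

locale minimizing_orbit = topological_group +
  fixes \<alpha> :: "'a \<Rightarrow> 'a" and V :: "'a set"
  assumes aut: "\<alpha> \<in> carrier (top_Aut G T)"
    and compact_open: "V \<in> compact_open_subgroups G T"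
    and minimal: "\<And>W. W \<in> compact_open_subgroups G T \<Longrightarrow>
      coset_count V (\<alpha> ` V) \<le> coset_count W (\<alpha> ` W)"
    and minimal_inv: "\<And>W. W \<in> compact_open_subgroups G T \<Longrightarrow>
      coset_count (\<alpha> ` V) V \<le> coset_count (\<alpha> ` W) W"
begin

section \<open>Translates of the minimizing subgroup and their factorization\<close>

definition U :: "int \<Rightarrow> 'a set" where
  "U k = (\<alpha> [^]\<^bsub>top_Aut G T\<^esub> k) ` V"

text \<open>For \<open>j < i\<close> the intersection is empty and equals \<open>UNIV\<close>;
  statements that treat \<open>seg i j\<close> as a subgroup therefore assume
  \<open>i \<le> j\<close>.\<close>

definition seg :: "int \<Rightarrow> int \<Rightarrow> 'a set" where
  "seg i j = (\<Inter>k\<in>{i..j}. U k)"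

lemma V_subset: "V \<subseteq> carrier G"
  using compact_open by (rule compact_open_subgroupsD)

lemma U_compact_open: "U k \<in> compact_open_subgroups G T"
  unfolding U_def using aut compact_open by (intro top_Aut_image_compact_open) auto

lemmas U_subgroup = compact_open_subgroupsD(1)[OF U_compact_open]
  and U_subset = compact_open_subgroupsD(4)[OF U_compact_open]

lemma U_0: "U 0 = V"
  by (simp add: U_def top_Aut_image_one V_subset)

lemma U_image_pow: "(\<alpha> [^]\<^bsub>top_Aut G T\<^esub> (k::int)) ` U j = U (k + j)"
  unfolding U_def using aut
  by (simp add: top_Aut_image_mult[symmetric] Aut.int_pow_mult V_subset)

lemma U_image: "\<alpha> ` U k = U (k + 1)"
  using U_image_pow[of 1 k] aut by (simp add: add.commute)

lemma coset_count_U_shift: "coset_count (U (k + i)) (U (k + j)) = coset_count (U i) (U j)"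
  using coset_count_image[of "\<alpha> [^]\<^bsub>top_Aut G T\<^esub> k" "U i" "U j"] aut U_subset
  by (simp add: U_image_pow)

lemma seg_image_pow:
  assumes "i \<le> j"
  shows "(\<alpha> [^]\<^bsub>top_Aut G T\<^esub> (k::int)) ` seg i j = seg (k + i) (k + j)"
proof -
  have "(\<alpha> [^]\<^bsub>top_Aut G T\<^esub> k) ` seg i j = (\<Inter>l\<in>{i..j}. (\<alpha> [^]\<^bsub>top_Aut G T\<^esub> k) ` U l)"
    unfolding seg_def
  proof (rule image_INT)
    show "inj_on (\<alpha> [^]\<^bsub>top_Aut G T\<^esub> k) (carrier G)" using aut by (intro top_AutD(2)) simp
    show "\<forall>l\<in>{i..j}. U l \<subseteq> carrier G" using U_subset by blast
    show "i \<in> {i..j}" using assms by simp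
  qed
  also have "\<dots> = (\<Inter>l\<in>(+) k ` {i..j}. U l)"
    by (simp only: U_image_pow image_image)
  also have "(+) k ` {i..j} = {k + i..k + j}" by simp
  finally show ?thesis by (simp add: seg_def)
qed

lemma seg_refl [simp]: "seg i i = U i"
  by (simp add: seg_def)

lemma seg_mono: "i' \<le> i \<Longrightarrow> j \<le> j' \<Longrightarrow> seg i' j' \<subseteq> seg i j"
  by (auto simp: seg_def)

lemma seg_subset_U: "i \<le> k \<Longrightarrow> k \<le> j \<Longrightarrow> seg i j \<subseteq> U k"
  by (auto simp: seg_def)

lemma seg_compact_open:
  assumes "i \<le> j"
  shows "seg i j \<in> compact_open_subgroups G T"
  using assms
proof (induction j rule: int_ge_induct)
  case (step j)
  then have "{i..j + 1} = insert (j + 1) {i..j}" by auto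
  then have "seg i (j + 1) = U (j + 1) \<inter> seg i j" by (simp add: seg_def)
  then show ?case using compact_open_subgroups_Int U_compact_open step by simp
qed (simp add: U_compact_open)

lemmas seg_subgroup = compact_open_subgroupsD(1)[OF seg_compact_open]
  and seg_subset = compact_open_subgroupsD(4)[OF seg_compact_open]

text \<open>Minimality is tested on \<open>?W\<close>, whose image is \<open>?X\<close>. As
  \<open>?X \<inter> ?W = ?X \<inter> U (k - 1)\<close>, it says that \<open>?X\<close> meets at
  least as many cosets of \<open>U (k - 1)\<close> as the larger group \<open>U k\<close>, hence all
  of the same ones.\<close>

lemma factor_one_step:
  assumes x: "x \<in> U k" and p: "p \<ge> 0"
  shows "\<exists>u\<in>U (k - 1). \<exists>v\<in>seg k (k + p). x = u \<otimes> v"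
proof -
  let ?W = "seg (k - 1) (k - 1 + p)" and ?X = "seg k (k + p)"
  have W: "?W \<in> compact_open_subgroups G T" and X: "?X \<in> compact_open_subgroups G T"
    using p by (auto intro: seg_compact_open)
  have aW: "\<alpha> ` ?W = ?X" using seg_image_pow[of "k - 1" "k - 1 + p" 1] p aut by simp
  have "?X \<inter> ?W = ?X \<inter> U (k - 1)"
  proof
    show "?X \<inter> ?W \<subseteq> ?X \<inter> U (k - 1)" using seg_subset_U[of "k - 1" "k - 1" "k - 1 + p"] p by auto
    show "?X \<inter> U (k - 1) \<subseteq> ?X \<inter> ?W"
    proof
      fix y assume y: "y \<in> ?X \<inter> U (k - 1)"
      have "y \<in> U l" if "l \<in> {k - 1..k - 1 + p}" for l
        using that y by (cases "l = k - 1") (auto simp: seg_def)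
      then show "y \<in> ?X \<inter> ?W" using y by (auto simp: seg_def)
    qed
  qed
  moreover have "coset_count V (\<alpha> ` V) \<le> coset_count ?W ?X" using minimal[OF W] aW by simp
  moreover have "coset_count V (\<alpha> ` V) = coset_count (U (k - 1)) (U k)"
    using coset_count_U_shift[of "k - 1" 0 1] U_image[of 0] by (simp add: U_0)
  ultimately have "coset_count (U (k - 1)) (U k) \<le> coset_count (U (k - 1)) ?X"
    using coset_count_Int W X U_subgroup compact_open_subgroupsD(1) by metis
  \<comment> \<open>An inclusion of finite sets together with the reverse inequality of
    cardinalities gives equality.\<close>
  then have "(\<lambda>y. U (k - 1) #> y) ` ?X = (\<lambda>y. U (k - 1) #> y) ` U k"
    unfolding coset_count_def
    using finite_cosets[OF U_compact_open U_compact_open] seg_subset_U[of k k "k + p"] p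
    by (intro card_seteq) auto
  then obtain v where v: "v \<in> ?X" "U (k - 1) #> x = U (k - 1) #> v" using x by blast
  have c: "x \<in> carrier G" "v \<in> carrier G"
    using x v(1) U_subset compact_open_subgroupsD(4)[OF X] by auto
  have "x \<otimes> inv v \<in> U (k - 1)" using r_coset_eq_iff[OF U_subgroup] c v by blast
  moreover have "x = (x \<otimes> inv v) \<otimes> v" using c by (simp add: m_assoc)
  ultimately show ?thesis using v by blast
qed

text \<open>The left segment grows by one index at a time: the left factor \<open>u\<close> is split
  again by \<open>factor_one_step\<close> at its leftmost index, and the new right factor is
  absorbed into \<open>v\<close>.\<close>

lemma factor_ex:
  assumes x: "x \<in> U k" and p: "p \<ge> 0"
  shows "\<exists>u\<in>seg (k - int n) k. \<exists>v\<in>seg k (k + p). x = u \<otimes> v"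
proof (induction n)
  case 0
  have "\<one> \<in> seg k (k + p)" using p by (intro subgroup.one_closed seg_subgroup) simp
  moreover have "x \<in> carrier G" using x U_subset by blast
  then have "x = x \<otimes> \<one>" by simp
  ultimately show ?case using x by auto
next
  case (Suc n)
  then obtain u v where uv: "u \<in> seg (k - int n) k" "v \<in> seg k (k + p)" "x = u \<otimes> v" by blast
  have "u \<in> U (k - int n)" using uv(1) seg_subset_U[of "k - int n" "k - int n" k] by auto
  \<comment> \<open>The length \<open>int n + p\<close> makes the segment of \<open>v'\<close> run
    from k - n to k + p. So \<open>v'\<close> can be multiplied into \<open>v\<close>, and it can be
    divided out of \<open>u\<close> within \<open>seg (k - int n) k\<close>.\<close>
  then obtain u' v' where u': "u' \<in> U (k - int n - 1)"
    and v': "v' \<in> seg (k - int n) (k - int n + (int n + p))" and u: "u = u' \<otimes> v'"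
    using factor_one_step[of u "k - int n" "int n + p"] p by auto
  have v'1: "v' \<in> seg k (k + p)" and v'2: "v' \<in> seg (k - int n) k"
    using v' p seg_mono[of "k - int n" k "k + p" "k + p"]
      seg_mono[of "k - int n" "k - int n" k "k + p"] by auto
  have c: "u' \<in> carrier G" "v' \<in> carrier G" "v \<in> carrier G"
    using subsetD[OF U_subset u'] subsetD[OF seg_subset v'2] subsetD[OF seg_subset uv(2)] p
    by auto
  have "u' = u \<otimes> inv v'" using c u by (simp add: m_assoc)
  then have "u' \<in> seg (k - int n) k"
    using seg_subgroup[of "k - int n" k] uv(1) v'2
    by (auto intro: subgroup.m_closed subgroup.m_inv_closed)
  then have "u' \<in> U l" if "l \<in> {k - int (Suc n)..k}" for l
    using that u' by (cases "l = k - int n - 1") (auto simp: seg_def)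
  then have "u' \<in> seg (k - int (Suc n)) k" by (auto simp: seg_def)
  moreover have "v' \<otimes> v \<in> seg k (k + p)"
    using v'1 uv(2) seg_subgroup[of k "k + p"] p by (auto intro: subgroup.m_closed)
  moreover have "x = u' \<otimes> (v' \<otimes> v)" using uv(3) u c by (simp add: m_assoc)
  ultimately show ?case by blast
qed

lemma factor:
  assumes "x \<in> U k" "i \<le> k" "k \<le> j"
  obtains u v where "u \<in> seg i k" "v \<in> seg k j" "x = u \<otimes> v"
  using factor_ex[of x k "j - k" "nat (k - i)"] assms by auto

text \<open>Inversion of a factorization of \<open>inv x\<close> reverses the order of the
  factors.\<close>

lemma factor_rev:
  assumes x: "x \<in> U k" and ij: "i \<le> k" "k \<le> j"
  obtains u v where "u \<in> seg i k" "v \<in> seg k j" "x = v \<otimes> u"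
proof -
  have xc: "x \<in> carrier G" using x U_subset by blast
  have "inv x \<in> U k" using x U_subgroup by (simp add: subgroup.m_inv_closed)
  then obtain u v where uv: "u \<in> seg i k" "v \<in> seg k j" "inv x = u \<otimes> v"
    using factor ij by blast
  then have c: "u \<in> carrier G" "v \<in> carrier G" using seg_subset ij by blast+
  have "x = inv v \<otimes> inv u" using uv(3) c xc by (metis inv_inv inv_mult_group)
  moreover have "inv u \<in> seg i k" "inv v \<in> seg k j"
    using uv seg_subgroup ij by (auto intro: subgroup.m_inv_closed)
  ultimately show ?thesis using that by blast
qed

section \<open>The recursion for the indices along the orbit\<close>

definition orbit_index :: "nat \<Rightarrow> nat" where
  "orbit_index n = coset_count (U 0) (U (int n))"

text \<open>This is the \<kappa> of the overview: the index of the triple intersection of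
  \<open>U (n + 1)\<close>, \<open>U n\<close> and \<open>U 0\<close> in
  \<open>U (n + 1) \<inter> U 0\<close>.\<close>

definition overlap_index :: "nat \<Rightarrow> nat" where
  "overlap_index n = coset_count (U (int n)) (U (int n + 1) \<inter> U 0)"

lemma orbit_index_pos: "orbit_index n > 0"
  unfolding orbit_index_def by (rule coset_count_compact_open_pos[OF U_compact_open U_compact_open])

text \<open>In a factorization of an element of \<open>U n\<close> at the index n, the left factor
  lies in \<open>U 0\<close> and is absorbed by the coset; the right factor lies in
  \<open>U n\<close> and in \<open>U (n + 1)\<close>.\<close>

lemma cosets_U_Int:
  assumes "n \<ge> 0"
  shows "(\<lambda>y. U 0 #> y) ` (U (n + 1) \<inter> U n) = (\<lambda>y. U 0 #> y) ` U n"
proof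
  show "(\<lambda>y. U 0 #> y) ` U n \<subseteq> (\<lambda>y. U 0 #> y) ` (U (n + 1) \<inter> U n)"
  proof
    fix Z assume "Z \<in> (\<lambda>y. U 0 #> y) ` U n"
    then obtain x where x: "x \<in> U n" "Z = U 0 #> x" by blast
    obtain u v where uv: "u \<in> seg 0 n" "v \<in> seg n (n + 1)" "x = u \<otimes> v"
      using factor[of x n 0 "n + 1"] x assms by auto
    have "u \<in> U 0" "v \<in> U n" "v \<in> U (n + 1)"
      using uv assms by (auto simp: seg_def)
    moreover from this have "Z = U 0 #> v"
      using x uv r_coset_mult_subgroup[OF U_subgroup, of u 0 v] U_subset by blast
    ultimately show "Z \<in> (\<lambda>y. U 0 #> y) ` (U (n + 1) \<inter> U n)" by blast
  qed
qed auto

text \<open>Equivalently, the product sets of \<open>U 0\<close> and \<open>U n\<close> increase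
  with n, so equal indices at N and N + 1 mean equal product sets.\<close>

lemma cosets_U_mono: "(\<lambda>y. U 0 #> y) ` U (int n) \<subseteq> (\<lambda>y. U 0 #> y) ` U (int (Suc n))"
proof -
  have "(\<lambda>y. U 0 #> y) ` (U (int n + 1) \<inter> U (int n)) \<subseteq> (\<lambda>y. U 0 #> y) ` U (int n + 1)"
    by (rule image_mono) simp
  then show ?thesis using cosets_U_Int[of "int n"] by (simp add: add.commute)
qed

text \<open>Both sides are the index in \<open>U (n + 1)\<close> of its intersection with
  \<open>U n\<close> and \<open>U 0\<close>, computed once through
  \<open>U (n + 1) \<inter> U 0\<close> and once through
  \<open>U (n + 1) \<inter> U n\<close>.\<close>

lemma orbit_index_rec: "orbit_index (Suc n) * overlap_index n = orbit_index 1 * orbit_index n"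
proof -
  let ?J = "U (int n + 1)" and ?L = "U (int n)"
  note sub = U_subgroup subgroups_Inter_pair
  have J: "?J \<subseteq> carrier G" by (rule U_subset)
  have JJ: "x \<otimes> y \<in> ?J" if "x \<in> ?J" "y \<in> ?J" for x y
    using that U_subgroup by (auto intro: subgroup.m_closed)
  have "coset_count (?J \<inter> ?L \<inter> U 0) ?J =
      coset_count (?J \<inter> ?L) ?J * coset_count (?J \<inter> ?L \<inter> U 0) (?J \<inter> ?L)"
    by (rule coset_count_refine) (use sub J JJ in auto)
  also have "coset_count (?J \<inter> ?L) ?J = orbit_index 1"
    using coset_count_Int[OF U_subgroup U_subgroup] coset_count_U_shift[of "int n" 0 1]
    by (simp add: orbit_index_def)
  also have "coset_count (?J \<inter> ?L \<inter> U 0) (?J \<inter> ?L) = orbit_index n"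
    using coset_count_Int[of "?J \<inter> ?L" "U 0"] sub cosets_U_Int[of "int n"]
    by (simp add: orbit_index_def coset_count_def)
  finally have 1: "coset_count (?J \<inter> ?L \<inter> U 0) ?J = orbit_index 1 * orbit_index n" .
  have "coset_count (?J \<inter> U 0 \<inter> ?L) ?J =
      coset_count (?J \<inter> U 0) ?J * coset_count (?J \<inter> U 0 \<inter> ?L) (?J \<inter> U 0)"
    by (rule coset_count_refine) (use sub J JJ in auto)
  also have "coset_count (?J \<inter> U 0) ?J = orbit_index (Suc n)"
    using coset_count_Int[OF U_subgroup U_subgroup] by (simp add: orbit_index_def add.commute)
  also have "coset_count (?J \<inter> U 0 \<inter> ?L) (?J \<inter> U 0) = overlap_index n"
    using coset_count_Int[of "?J \<inter> U 0" ?L] sub by (simp add: overlap_index_def)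
  finally have "coset_count (?J \<inter> U 0 \<inter> ?L) ?J = orbit_index (Suc n) * overlap_index n" .
  moreover have "?J \<inter> U 0 \<inter> ?L = ?J \<inter> ?L \<inter> U 0" by blast
  ultimately show ?thesis using 1 by simp
qed

text \<open>After applying \<alpha>, cosets met by \<open>U (n + 2) \<inter> U 1\<close> must be
  shown to be met by \<open>U (n + 2) \<inter> U 0\<close>. An element x of the former is v u with v
  in \<open>U (n + 1)\<close> and u in the latter; the reversed factorization is chosen because
  right cosets absorb left factors.\<close>

lemma overlap_index_mono: "overlap_index n \<le> overlap_index (Suc n)"
proof -
  let ?m = "int n + 1"
  have inj: "inj_on \<alpha> (carrier G)" by (rule top_AutD(2)[OF aut])
  have "overlap_index n = coset_count (\<alpha> ` U (int n)) (\<alpha> ` (U ?m \<inter> U 0))"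
    unfolding overlap_index_def using U_subset by (intro coset_count_image[symmetric] aut) auto
  also have "\<alpha> ` (U ?m \<inter> U 0) = U (?m + 1) \<inter> U 1"
    using inj_on_image_Int[OF inj U_subset U_subset] U_image[of 0] by (simp add: U_image)
  finally have "overlap_index n = coset_count (U ?m) (U (?m + 1) \<inter> U 1)" by (simp add: U_image)
  also have "\<dots> \<le> coset_count (U ?m) (U (?m + 1) \<inter> U 0)"
    unfolding coset_count_def
  proof (rule card_mono)
    show "finite ((\<lambda>y. U ?m #> y) ` (U (?m + 1) \<inter> U 0))"
      by (intro finite_cosets compact_open_subgroups_Int U_compact_open)
    show "(\<lambda>y. U ?m #> y) ` (U (?m + 1) \<inter> U 1) \<subseteq> (\<lambda>y. U ?m #> y) ` (U (?m + 1) \<inter> U 0)"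
    proof
      fix Z assume "Z \<in> (\<lambda>y. U ?m #> y) ` (U (?m + 1) \<inter> U 1)"
      then obtain x where x: "x \<in> U (?m + 1)" "x \<in> U 1" "Z = U ?m #> x" by blast
      obtain u v where uv: "u \<in> seg 0 1" "v \<in> seg 1 (?m + 1)" "x = v \<otimes> u"
        using factor_rev[of x 1 0 "?m + 1"] x by auto
      have mem: "v \<in> U ?m" "v \<in> U (?m + 1)" "u \<in> U 0" using uv by (auto simp: seg_def)
      then have c: "u \<in> carrier G" "v \<in> carrier G" using U_subset by blast+
      have "u = inv v \<otimes> x" using uv(3) c by (simp add: m_assoc[symmetric])
      then have "u \<in> U (?m + 1)"
        using mem x U_subgroup by (auto intro: subgroup.m_closed subgroup.m_inv_closed)
      moreover have "Z = U ?m #> u"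
        using x uv mem c r_coset_mult_subgroup[OF U_subgroup] by blast
      ultimately show "Z \<in> (\<lambda>y. U ?m #> y) ` (U (?m + 1) \<inter> U 0)" using mem by blast
    qed
  qed
  finally show ?thesis by (simp add: overlap_index_def add.commute)
qed

lemma overlap_index_le: "overlap_index n \<le> orbit_index 1"
proof -
  have "overlap_index n \<le> coset_count (U (int n)) (U (int n + 1))"
    unfolding overlap_index_def by (intro coset_count_mono finite_cosets U_compact_open) auto
  then show ?thesis using coset_count_U_shift[of "int n" 0 1] by (simp add: orbit_index_def)
qed

lemma orbit_index_eventually_geometric:
  "\<exists>N q. q > 0 \<and> (\<forall>n. orbit_index (N + n) = q ^ n * orbit_index N)"
  by (rule eventually_geometric[of orbit_index "orbit_index 1" overlap_index])
    (use orbit_index_pos orbit_index_rec overlap_index_mono overlap_index_le in auto)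

end

text \<open>The error is constant from \<open>N\<close> on, so it takes finitely many values and has
  a maximum.\<close>

lemma ln_eventually_geometric:
  fixes a :: "nat \<Rightarrow> nat"
  assumes pos: "q > 0" "\<And>n. a n > 0" and geo: "\<And>n. a (N + n) = q ^ n * a N"
  shows "\<exists>C. \<forall>n. \<bar>ln (real (a n)) - real n * ln (real q)\<bar> \<le> C"
proof -
  let ?f = "\<lambda>n. \<bar>ln (real (a n)) - real n * ln (real q)\<bar>"
  have "?f (N + n) = ?f N" for n
  proof -
    have "ln (real (a (N + n))) = real n * ln (real q) + ln (real (a N))"
      using pos by (simp add: geo ln_mult ln_realpow)
    then show ?thesis by (simp add: algebra_simps)
  qed
  then have "?f n \<in> ?f ` {..N}" for n
  proof (cases "n \<le> N")
    case False
    then have "?f n = ?f N" using \<open>\<And>n. ?f (N + n) = ?f N\<close>[of "n - N"] by simp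
    then show ?thesis by (rule image_eqI) simp
  qed simp
  then have "?f n \<le> Max (?f ` {..N})" for n by (intro Max_ge) auto
  then show ?thesis by blast
qed

section \<open>Linear growth of the distance along the orbit\<close>

context minimizing_orbit
begin

text \<open>Applying \<alpha> turns the two minimality conditions for the inverse into those for
  \<alpha> with their roles exchanged; the competitor \<open>W\<close> is replaced by its
  preimage.\<close>

lemma minimizing_orbit_inv: "minimizing_orbit G T (inv\<^bsub>top_Aut G T\<^esub> \<alpha>) V"
proof (intro minimizing_orbit.intro minimizing_orbit_axioms.intro topological_group_axioms)
  let ?\<beta> = "inv\<^bsub>top_Aut G T\<^esub> \<alpha>"
  show b: "?\<beta> \<in> carrier (top_Aut G T)" using aut by simp
  show "V \<in> compact_open_subgroups G T" by (rule compact_open)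
  have 1: "coset_count X (?\<beta> ` X) = coset_count (\<alpha> ` X) X"
    and 2: "coset_count (?\<beta> ` X) X = coset_count X (\<alpha> ` X)"
    and 3: "coset_count X (?\<beta> ` X) = coset_count (\<alpha> ` ?\<beta> ` X) (?\<beta> ` X)"
    and 4: "coset_count (?\<beta> ` X) X = coset_count (?\<beta> ` X) (\<alpha> ` ?\<beta> ` X)"
    if X: "X \<subseteq> carrier G" for X
  proof -
    have bX: "?\<beta> ` X \<subseteq> carrier G" using top_AutD(3)[OF b] X by blast
    show "coset_count X (?\<beta> ` X) = coset_count (\<alpha> ` X) X"
      using coset_count_image[OF aut X bX] top_Aut_image_inv[OF aut X] by simp
    show "coset_count (?\<beta> ` X) X = coset_count X (\<alpha> ` X)"
      using coset_count_image[OF aut bX X] top_Aut_image_inv[OF aut X] by simp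
    show "coset_count X (?\<beta> ` X) = coset_count (\<alpha> ` ?\<beta> ` X) (?\<beta> ` X)"
      and "coset_count (?\<beta> ` X) X = coset_count (?\<beta> ` X) (\<alpha> ` ?\<beta> ` X)"
      using top_Aut_image_inv[OF aut X] by simp_all
  qed
  fix W assume W: "W \<in> compact_open_subgroups G T"
  have W': "?\<beta> ` W \<in> compact_open_subgroups G T" by (rule top_Aut_image_compact_open[OF b W])
  show "coset_count V (?\<beta> ` V) \<le> coset_count W (?\<beta> ` W)"
    using minimal_inv[OF W'] 1[OF V_subset] 3[OF compact_open_subgroupsD(4)[OF W]] by simp
  show "coset_count (?\<beta> ` V) V \<le> coset_count (?\<beta> ` W) W"
    using minimal[OF W'] 2[OF V_subset] 4[OF compact_open_subgroupsD(4)[OF W]] by simp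
qed

text \<open>Constancy at N gives \<alpha>(Y) \<subseteq> Y for the product set \<open>Y\<close>.
  Counting cosets of \<open>?D\<close> in both sets yields the first inequality. When the reverse
  inequality holds too, \<alpha>(Y) = Y, and minimality against the stabilizer of \<open>Y\<close>
  forces index 1.\<close>

lemma
  assumes const: "orbit_index (Suc N) = orbit_index N"
  shows eventually_const_coset_count_le: "coset_count (U 0) (U 1) \<le> coset_count (U 1) (U 0)"
    and eventually_const_image_subset:
      "coset_count (U 1) (U 0) \<le> coset_count (U 0) (U 1) \<Longrightarrow> U 1 \<subseteq> U 0"
proof -
  define Y where "Y = U 0 <#> U (int N)"
  let ?D = "U 0 \<inter> U 1"
  interpret \<alpha>: group_hom G G \<alpha> by (rule top_AutD(1)[OF aut])
  have D: "subgroup ?D G" by (intro subgroups_Inter_pair U_subgroup)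
  have Yc: "Y \<subseteq> carrier G" unfolding Y_def by (intro set_mult_closed U_subset)
  have stab: "l \<otimes> y \<in> Y" if l: "l \<in> U 0" and y: "y \<in> Y" for l y
  proof -
    obtain h k where hk: "h \<in> U 0" "k \<in> U (int N)" "y = h \<otimes> k" using y by (auto simp: Y_def set_mult_def)
    then have "l \<otimes> y = (l \<otimes> h) \<otimes> k" using l U_subset by (metis m_assoc subsetD)
    moreover have "l \<otimes> h \<in> U 0" using l hk U_subgroup by (simp add: subgroup.m_closed)
    ultimately show ?thesis using hk by (auto simp: Y_def set_mult_def)
  qed
  have UNY: "U (int N) \<subseteq> Y"
  proof
    fix k assume k: "k \<in> U (int N)"
    then have "k = \<one> \<otimes> k" using U_subset by (metis l_one subsetD)
    then show "k \<in> Y" using k subgroup.one_closed[OF U_subgroup] unfolding Y_def set_mult_def by blast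
  qed
  have "U 0 #> y \<in> (\<lambda>y. U 0 #> y) ` U (int N)" if y: "y \<in> Y" for y
  proof -
    obtain h k where hk: "h \<in> U 0" "k \<in> U (int N)" "y = h \<otimes> k" using y by (auto simp: Y_def set_mult_def)
    then have "U 0 #> y = U 0 #> k" using r_coset_mult_subgroup[OF U_subgroup] U_subset by blast
    then show ?thesis using hk by blast
  qed
  then have cosY: "(\<lambda>y. U 0 #> y) ` Y = (\<lambda>y. U 0 #> y) ` U (int N)" using UNY by blast
  \<comment> \<open>This is where constancy enters: \<open>U (N + 1)\<close> meets no new coset of
    \<open>U 0\<close> and thus lies in \<open>Y\<close>.\<close>
  have cosN: "(\<lambda>y. U 0 #> y) ` U (int N) = (\<lambda>y. U 0 #> y) ` U (int (Suc N))"
    using const by (intro card_seteq cosets_U_mono finite_cosets U_compact_open)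
      (simp add: orbit_index_def coset_count_def)
  have aYc: "\<alpha> ` Y \<subseteq> carrier G" using Yc by auto
  have aY: "\<alpha> ` Y \<subseteq> Y"
  proof
    fix z assume "z \<in> \<alpha> ` Y"
    then obtain h k where hk: "h \<in> U 0" "k \<in> U (int N)" "z = \<alpha> (h \<otimes> k)"
      by (auto simp: Y_def set_mult_def)
    then have z: "z = \<alpha> h \<otimes> \<alpha> k" using U_subset by (metis \<alpha>.hom_mult subsetD)
    have ah: "\<alpha> h \<in> U 1" using hk U_image[of 0] by auto
    have ak: "\<alpha> k \<in> U (int (Suc N))" using hk U_image[of "int N"] by (auto simp: add.commute)
    \<comment> \<open>The factor \<open>u\<close> stays in \<open>U 0\<close>, which stabilizes
      \<open>Y\<close>, while \<open>v\<close> lies in \<open>U (N + 1)\<close> and joins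
      \<alpha>(k) there.\<close>
    obtain u v where uv: "u \<in> seg 0 1" "v \<in> seg 1 (int (Suc N))" "\<alpha> h = u \<otimes> v"
      using factor[OF ah, of 0 "int (Suc N)"] by auto
    have mem: "u \<in> U 0" "v \<in> U (int (Suc N))" using uv by (auto simp: seg_def)
    then have vk: "v \<otimes> \<alpha> k \<in> U (int (Suc N))"
      using ak U_subgroup by (simp add: subgroup.m_closed)
    have c: "u \<in> carrier G" "v \<in> carrier G" "\<alpha> k \<in> carrier G" "v \<otimes> \<alpha> k \<in> carrier G"
      using mem ak vk U_subset by blast+
    obtain x where x: "x \<in> U (int N)" "U 0 #> (v \<otimes> \<alpha> k) = U 0 #> x"
      using vk cosN by (metis (no_types, lifting) imageE imageI)
    then have "v \<otimes> \<alpha> k \<in> U 0 #> x" using rcos_self[OF c(4) U_subgroup] by metis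
    then obtain w where w: "w \<in> U 0" "v \<otimes> \<alpha> k = w \<otimes> x" by (auto simp: r_coset_def)
    then have "v \<otimes> \<alpha> k \<in> Y" using x by (auto simp: Y_def set_mult_def)
    then have "u \<otimes> (v \<otimes> \<alpha> k) \<in> Y" using stab mem by blast
    then show "z \<in> Y" using z uv c by (simp add: m_assoc)
  qed
  have astab: "l \<otimes> y \<in> \<alpha> ` Y" if l: "l \<in> U 1" and y: "y \<in> \<alpha> ` Y" for l y
  proof -
    have "l \<in> \<alpha> ` U 0" using l U_image[of 0] by simp
    then obtain l' y' where *: "l' \<in> U 0" "l = \<alpha> l'" "y' \<in> Y" "y = \<alpha> y'"
      using y by blast
    then have "l \<otimes> y = \<alpha> (l' \<otimes> y')" using U_subset Yc by (metis \<alpha>.hom_mult subsetD)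
    then show ?thesis using stab * by blast
  qed
  \<comment> \<open>\<open>?D\<close> serves as a common unit of size for \<open>Y\<close>, which is
    stable under \<open>U 0\<close>, and its image, which is stable under
    \<open>U 1\<close>.\<close>
  have "coset_count ?D Y = coset_count (U 0) Y * coset_count ?D (U 0)"
    by (rule coset_count_refine[OF D U_subgroup _ Yc stab]) auto
  also have "\<dots> = orbit_index N * coset_count (U 1) (U 0)"
    using coset_count_Int[OF U_subgroup U_subgroup] cosY by (simp add: orbit_index_def coset_count_def)
  finally have cDY: "coset_count ?D Y = orbit_index N * coset_count (U 1) (U 0)" .
  have "coset_count ?D (\<alpha> ` Y) = coset_count (U 1) (\<alpha> ` Y) * coset_count ?D (U 1)"
    by (rule coset_count_refine[OF D U_subgroup _ aYc astab]) auto
  also have "coset_count (U 1) (\<alpha> ` Y) = orbit_index N"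
    using coset_count_image[OF aut U_subset Yc, of 0] U_image[of 0] cosY
    by (simp add: orbit_index_def coset_count_def)
  also have "coset_count ?D (U 1) = coset_count (U 0) (U 1)"
    using coset_count_Int[OF U_subgroup[of 1] U_subgroup[of 0]] by (simp add: Int_commute)
  finally have cDaY: "coset_count ?D (\<alpha> ` Y) = orbit_index N * coset_count (U 0) (U 1)" .
  have finDY: "finite ((\<lambda>y. ?D #> y) ` Y)"
  proof (rule finite_cosets_refine[OF D U_subgroup _ Yc stab])
    show "finite ((\<lambda>y. U 0 #> y) ` Y)" unfolding cosY by (intro finite_cosets U_compact_open)
    show "finite ((\<lambda>y. ?D #> y) ` U 0)"
      by (intro finite_cosets compact_open_subgroups_Int U_compact_open)
  qed auto
  show "coset_count (U 0) (U 1) \<le> coset_count (U 1) (U 0)"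
    using coset_count_mono[OF aY finDY] orbit_index_pos[of N] by (simp add: cDY cDaY)
  assume ge: "coset_count (U 1) (U 0) \<le> coset_count (U 0) (U 1)"
  have cosD: "(\<lambda>y. ?D #> y) ` \<alpha> ` Y = (\<lambda>y. ?D #> y) ` Y"
    using cDY cDaY ge by (intro card_seteq finDY image_mono aY) (simp add: coset_count_def)
  \<comment> \<open>The image of \<open>Y\<close> is a union of \<open>?D\<close>-cosets, as it is
    stable under \<open>U 1\<close>, and it meets all the \<open>?D\<close>-cosets that
    \<open>Y\<close> meets.\<close>
  have aYeq: "\<alpha> ` Y = Y"
  proof (intro equalityI aY subsetI)
    fix y assume y: "y \<in> Y"
    then obtain z where z: "z \<in> \<alpha> ` Y" "?D #> y = ?D #> z"
      using cosD by (metis (no_types, lifting) imageE imageI)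
    have c: "y \<in> carrier G" "z \<in> carrier G" using y z aYc Yc by blast+
    have "y \<otimes> inv z \<in> U 1" using z(2) r_coset_eq_iff[OF D] c by blast
    then have "(y \<otimes> inv z) \<otimes> z \<in> \<alpha> ` Y" using astab z by blast
    then show "y \<in> \<alpha> ` Y" using c by (simp add: m_assoc)
  qed
  \<comment> \<open>Equality instead of inclusion makes this left stabilizer closed under inverses.
    It contains \<open>U 0\<close>, and it lies in \<open>Y\<close> because \<open>Y\<close>
    contains the identity.\<close>
  define M where "M = {g \<in> carrier G. (\<lambda>y. g \<otimes> y) ` Y = Y}"
  have comp: "(\<lambda>y. (g \<otimes> h) \<otimes> y) ` Y = (\<lambda>y. g \<otimes> y) ` (\<lambda>y. h \<otimes> y) ` Y"
    if "g \<in> carrier G" "h \<in> carrier G" for g h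
    unfolding image_image using that Yc by (intro image_cong) (auto simp: m_assoc)
  have one: "(\<lambda>y. \<one> \<otimes> y) ` Y = Y"
    using Yc by (force simp: image_iff)
  have M: "subgroup M G"
  proof (rule subgroupI)
    show "M \<noteq> {}" using one by (auto simp: M_def)
    fix g h assume g: "g \<in> M" and h: "h \<in> M"
    show "g \<otimes> h \<in> M" using g h comp by (simp add: M_def)
    have "(\<lambda>y. inv g \<otimes> y) ` Y = (\<lambda>y. inv g \<otimes> y) ` (\<lambda>y. g \<otimes> y) ` Y"
      using g by (simp add: M_def)
    also have "\<dots> = Y" using g one comp[of "inv g" g] by (simp add: M_def)
    finally show "inv g \<in> M" using g by (simp add: M_def)
  qed (auto simp: M_def)
  have UM: "U 0 \<subseteq> M"
  proof
    fix l assume l: "l \<in> U 0"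
    then have lc: "l \<in> carrier G" using U_subset by blast
    have "y \<in> (\<lambda>y. l \<otimes> y) ` Y" if "y \<in> Y" for y
    proof
      show "inv l \<otimes> y \<in> Y" using stab l that U_subgroup by (simp add: subgroup.m_inv_closed)
      show "y = l \<otimes> (inv l \<otimes> y)" using lc that Yc by (auto simp: m_assoc[symmetric])
    qed
    then show "l \<in> M" using lc stab l by (auto simp: M_def)
  qed
  have "M \<subseteq> Y"
  proof
    fix g assume g: "g \<in> M"
    have "\<one> \<in> Y" using UNY subgroup.one_closed[OF U_subgroup] by blast
    then have "g \<otimes> \<one> \<in> (\<lambda>y. g \<otimes> y) ` Y" by (rule imageI)
    then show "g \<in> Y" using g by (simp add: M_def)
  qed
  then have "finite ((\<lambda>y. U 0 #> y) ` M)"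
    using cosY finite_cosets[OF U_compact_open U_compact_open]
    by (metis finite_subset image_mono)
  then have Mco: "M \<in> compact_open_subgroups G T"
    by (rule compact_open_subgroups_superset[OF U_compact_open M UM])
  have "\<alpha> ` M \<subseteq> M"
  proof
    fix z assume "z \<in> \<alpha> ` M"
    then obtain g where g: "g \<in> M" "z = \<alpha> g" by blast
    then have gc: "g \<in> carrier G" by (simp add: M_def)
    have "(\<lambda>y. z \<otimes> y) ` Y = (\<lambda>y. z \<otimes> y) ` \<alpha> ` Y" by (simp add: aYeq)
    also have "\<dots> = \<alpha> ` (\<lambda>y. g \<otimes> y) ` Y"
      unfolding image_image using g gc Yc by (intro image_cong) auto
    also have "\<dots> = Y" using g aYeq by (simp add: M_def)
    finally show "z \<in> M" using g gc by (simp add: M_def)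
  qed
  then have "coset_count M (\<alpha> ` M) = 1"
    using coset_count_eq_1_iff[OF compact_open_subgroupsD(1)[OF top_Aut_image_compact_open[OF aut Mco]] M]
    by simp
  then have "coset_count (U 0) (U 1) \<le> 1" using minimal[OF Mco] U_image[of 0] by (simp add: U_0)
  then have "coset_count (U 0) (U 1) = 1"
    using coset_count_compact_open_pos[OF U_compact_open[of 1] U_compact_open[of 0]] by simp
  then show "U 1 \<subseteq> U 0" using coset_count_eq_1_iff[OF U_subgroup U_subgroup] by blast
qed

text \<open>The two logarithms in the distance are those of the index sequences of \<alpha> and of
  its inverse, with eventual ratios \<open>q\<close> and \<open>q'\<close>. The gap at
  \<open>ln 2\<close> is due to these being positive integers: either both are 1 or one is at least
  2.\<close>

lemma subgroup_dist_pow_growth: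
  "\<exists>l C. (l = 0 \<and> \<alpha> ` V = V \<or> ln 2 \<le> l) \<and>
    (\<forall>n. \<bar>subgroup_dist G V ((\<alpha> [^]\<^bsub>top_Aut G T\<^esub> int n) ` V) - real n * l\<bar> \<le> C)"
proof -
  interpret inv: minimizing_orbit G T "inv\<^bsub>top_Aut G T\<^esub> \<alpha>" V by (rule minimizing_orbit_inv)
  have invU: "inv.U k = U (- k)" for k
    using aut by (simp add: inv.U_def U_def Aut.int_pow_inv Aut.int_pow_neg)
  have inva: "inv.orbit_index n = coset_count (U (int n)) (U 0)" for n
    using coset_count_U_shift[of "int n" 0 "- int n"] by (simp add: inv.orbit_index_def invU)
  obtain N q where q: "q > 0" "\<And>n. orbit_index (N + n) = q ^ n * orbit_index N"
    using orbit_index_eventually_geometric by blast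
  obtain N' q' where q': "q' > 0" "\<And>n. inv.orbit_index (N' + n) = q' ^ n * inv.orbit_index N'"
    using inv.orbit_index_eventually_geometric by blast
  obtain C where C: "\<And>n. \<bar>ln (real (orbit_index n)) - real n * ln (real q)\<bar> \<le> C"
    using ln_eventually_geometric[OF q(1) orbit_index_pos q(2)] by blast
  obtain C' where C': "\<And>n. \<bar>ln (real (inv.orbit_index n)) - real n * ln (real q')\<bar> \<le> C'"
    using ln_eventually_geometric[OF q'(1) inv.orbit_index_pos q'(2)] by blast
  let ?l = "ln (real q) + ln (real q')"
  have dist: "subgroup_dist G V ((\<alpha> [^]\<^bsub>top_Aut G T\<^esub> int n) ` V) =
      ln (real (inv.orbit_index n)) + ln (real (orbit_index n))" for n
    using subgroup_dist_eq[OF U_compact_open[of 0] U_compact_open[of "int n"]]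
    by (simp add: U_0 orbit_index_def inva U_def[symmetric])
  have "\<bar>subgroup_dist G V ((\<alpha> [^]\<^bsub>top_Aut G T\<^esub> int n) ` V) - real n * ?l\<bar> \<le> C + C'" for n
    using C[of n] C'[of n] by (simp add: dist algebra_simps abs_le_iff)
  moreover have "?l = 0 \<and> \<alpha> ` V = V \<or> ln 2 \<le> ?l"
  proof (cases "q = 1 \<and> q' = 1")
    case True
    then have const: "orbit_index (Suc N) = orbit_index N"
      "inv.orbit_index (Suc N') = inv.orbit_index N'"
      using q(2)[of 1] q'(2)[of 1] by simp_all
    have shift: "coset_count (U 0) (U (- 1)) = coset_count (U 1) (U 0)"
      "coset_count (U (- 1)) (U 0) = coset_count (U 0) (U 1)"
      using coset_count_U_shift[of 1 0 "- 1"] coset_count_U_shift[of 1 "- 1" 0] by simp_all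
    \<comment> \<open>With both sequences eventually constant, \<alpha> and its inverse each supply
      the inequality that the other requires.\<close>
    have le: "coset_count (U 0) (U 1) \<le> coset_count (U 1) (U 0)"
      "coset_count (U 1) (U 0) \<le> coset_count (U 0) (U 1)"
      using eventually_const_coset_count_le[OF const(1)]
        inv.eventually_const_coset_count_le[OF const(2)] by (simp_all add: invU shift)
    have "U 1 \<subseteq> U 0" using eventually_const_image_subset[OF const(1)] le by blast
    moreover have "U (- 1) \<subseteq> U 0"
      using inv.eventually_const_image_subset[OF const(2)] le by (simp add: invU shift)
    then have "\<alpha> ` U (- 1) \<subseteq> \<alpha> ` U 0" by (rule image_mono)
    ultimately have "\<alpha> ` V = V" using U_image[of 0] U_image[of "- 1"] by (simp add: U_0)
    then show ?thesis using True by simp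
  next
    case False
    then have "q \<ge> 2 \<or> q' \<ge> 2" using q(1) q'(1) by linarith
    moreover have "ln (real q) \<ge> 0" "ln (real q') \<ge> 0" using q(1) q'(1) by simp_all
    ultimately have "ln 2 \<le> ln (real q) + ln (real q')"
    proof (elim disjE)
      assume "q \<ge> 2"
      then have "ln 2 \<le> ln (real q)" by simp
      then show ?thesis using \<open>ln (real q') \<ge> 0\<close> by simp
    next
      assume "q' \<ge> 2"
      then have "ln 2 \<le> ln (real q')" by simp
      then show ?thesis using \<open>ln (real q) \<ge> 0\<close> by simp
    qed
    then show ?thesis by blast
  qed
  ultimately show ?thesis by blast
qed

end

section \<open>Hyperbolic orbits\<close>

text \<open>This removes bounded errors when inequalities for M are passed to its growth
  rate.\<close>

lemma le_of_nat_multiples_le: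
  fixes x y C :: real
  assumes "\<And>n :: nat. real n * x \<le> real n * y + C"
  shows "x \<le> y"
proof (rule ccontr)
  assume "\<not> x \<le> y"
  then obtain n :: nat where "C < real n * (x - y)"
    using reals_Archimedean3[of "x - y"] by auto
  then show False using assms[of n] by (simp add: algebra_simps)
qed

section \<open>Euclid's algorithm for growth rates on pairs of integers\<close>

definition scale2 :: "nat \<Rightarrow> int \<times> int \<Rightarrow> int \<times> int" where
  "scale2 n u = (int n * fst u, int n * snd u)"

text \<open>\<open>M (a - b)\<close> plays the role of a translation-invariant distance. Each
  Euclidean step lowers l x + l y by at least \<epsilon>, so the uniform lower bound on l is what
  makes the descent contradictory.\<close>

lemma linear_growth_int2_not_hyperbolic:
  fixes M :: "int \<times> int \<Rightarrow> real" and K \<epsilon> :: real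
  assumes sym: "\<And>u. M (- u) = M u" and \<epsilon>: "\<epsilon> > 0"
    and growth: "\<And>u. u \<noteq> 0 \<Longrightarrow> \<exists>l C. \<epsilon> \<le> l \<and> (\<forall>n. \<bar>M (scale2 n u) - real n * l\<bar> \<le> C)"
    and four_point: "\<And>a b c d. M (a - b) + M (c - d) \<le>
      max (M (a - c) + M (b - d)) (M (a - d) + M (b - c)) + K"
  shows False
proof -
  obtain l C where l: "\<And>u. u \<noteq> 0 \<Longrightarrow> \<epsilon> \<le> l u"
    and C: "\<And>u n. u \<noteq> 0 \<Longrightarrow> \<bar>M (scale2 n u) - real n * l u\<bar> \<le> C u"
    using growth by metis
  have scale_add: "scale2 n (x + y) = scale2 n x + scale2 n y"
    and scale_diff: "scale2 n (x - y) = scale2 n x - scale2 n y" for n x y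
    by (simp_all add: scale2_def plus_prod_def minus_prod_def algebra_simps)
  have l_max: "l x + l y \<le> max (l (x + y)) (l (x - y))"
    if "x \<noteq> 0" "y \<noteq> 0" "x + y \<noteq> 0" "x - y \<noteq> 0" for x y
  proof -
    have "2 * (l x + l y) \<le> 2 * max (l (x + y)) (l (x - y))"
    proof (rule le_of_nat_multiples_le)
        fix n :: nat
        let ?X = "scale2 n x" and ?Y = "scale2 n y"
        \<comment> \<open>The four points are 0, 2nx, n(x + y) and n(x - y): the chosen pairing has
          differences 2nx and 2ny, and each other pairing repeats one difference up to sign.\<close>
        have "M (scale2 (2 * n) x) + M (scale2 (2 * n) y) = M (0 - (?X + ?X)) + M ((?X + ?Y) - (?X - ?Y))"
          using sym[of "?X + ?X"] by (simp add: scale2_def plus_prod_def minus_prod_def uminus_prod_def algebra_simps)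
        also have "\<dots> \<le> max (M (0 - (?X + ?Y)) + M ((?X + ?X) - (?X - ?Y)))
            (M (0 - (?X - ?Y)) + M ((?X + ?X) - (?X + ?Y))) + K"
          by (rule four_point)
        also have "\<dots> = 2 * max (M (scale2 n (x + y))) (M (scale2 n (x - y))) + K"
          using sym[of "?X + ?Y"] sym[of "?X - ?Y"] by (simp add: scale_add scale_diff max_def)
        finally have "M (scale2 (2 * n) x) + M (scale2 (2 * n) y)
          \<le> 2 * max (M (scale2 n (x + y))) (M (scale2 n (x - y))) + K" .
        moreover have "max (M (scale2 n (x + y))) (M (scale2 n (x - y)))
          \<le> real n * max (l (x + y)) (l (x - y)) + (C (x + y) + C (x - y))"
        proof (rule max.boundedI)
          have pos: "0 \<le> C (x + y)" "0 \<le> C (x - y)" using C[OF that(3), of 0] C[OF that(4), of 0] by linarith+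
          have "real n * l (x + y) \<le> real n * max (l (x + y)) (l (x - y))"
            "real n * l (x - y) \<le> real n * max (l (x + y)) (l (x - y))" by (auto intro: mult_left_mono)
          then show "M (scale2 n (x + y)) \<le> real n * max (l (x + y)) (l (x - y)) + (C (x + y) + C (x - y))"
            "M (scale2 n (x - y)) \<le> real n * max (l (x + y)) (l (x - y)) + (C (x + y) + C (x - y))"
            using C[OF that(3), of n] C[OF that(4), of n] pos by linarith+
        qed
        moreover have "2 * (real n * l x) - C x \<le> M (scale2 (2 * n) x)"
          "2 * (real n * l y) - C y \<le> M (scale2 (2 * n) y)"
          using C[OF that(1), of "2 * n"] C[OF that(2), of "2 * n"] by simp_all
        ultimately show "real n * (2 * (l x + l y)) \<le> real n * (2 * max (l (x + y)) (l (x - y)))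
          + (2 * (C (x + y) + C (x - y)) + C x + C y + K)"
          unfolding distrib_left mult.left_commute[of "real n" 2] by linarith
    qed
    then show ?thesis by simp
  qed
  have l_sum: "l (x + y) + l (x - y) \<le> 2 * max (l x) (l y)"
    if "x \<noteq> 0" "y \<noteq> 0" "x + y \<noteq> 0" "x - y \<noteq> 0" for x y
  proof (rule le_of_nat_multiples_le)
    fix n :: nat
    let ?X = "scale2 n x" and ?Y = "scale2 n y"
    \<comment> \<open>The four points are now the vertices 0, nx, ny, n(x + y) of a parallelogram,
      with its two diagonals on the left.\<close>
    have "M (scale2 n (x + y)) + M (scale2 n (x - y)) = M ((?X + ?Y) - 0) + M (?X - ?Y)"
      by (simp add: scale_add scale_diff)
    also have "\<dots> \<le> max (M ((?X + ?Y) - ?X) + M (0 - ?Y)) (M ((?X + ?Y) - ?Y) + M (0 - ?X)) + K"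
      by (rule four_point)
    also have "\<dots> = 2 * max (M ?X) (M ?Y) + K"
      using sym[of ?X] sym[of ?Y] by (simp add: max_def)
    finally have "M (scale2 n (x + y)) + M (scale2 n (x - y)) \<le> 2 * max (M ?X) (M ?Y) + K" .
    moreover have "max (M ?X) (M ?Y) \<le> real n * max (l x) (l y) + (C x + C y)"
    proof (rule max.boundedI)
      have pos: "0 \<le> C x" "0 \<le> C y" using C[OF that(1), of 0] C[OF that(2), of 0] by linarith+
      have "real n * l x \<le> real n * max (l x) (l y)" "real n * l y \<le> real n * max (l x) (l y)"
        by (auto intro: mult_left_mono)
      then show "M ?X \<le> real n * max (l x) (l y) + (C x + C y)"
        "M ?Y \<le> real n * max (l x) (l y) + (C x + C y)"
        using C[OF that(1), of n] C[OF that(2), of n] pos by linarith+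
    qed
    moreover have "real n * l (x + y) - C (x + y) \<le> M (scale2 n (x + y))"
      "real n * l (x - y) - C (x - y) \<le> M (scale2 n (x - y))"
      using C[OF that(3), of n] C[OF that(4), of n] by simp_all
    ultimately show "real n * (l (x + y) + l (x - y)) \<le> real n * (2 * max (l x) (l y))
      + (2 * (C x + C y) + C (x + y) + C (x - y) + K)"
      unfolding distrib_left mult.left_commute[of "real n" 2] by linarith
  qed
  \<comment> \<open>The determinant survives the steps up to sign, and its being nonzero keeps x, y,
    x + y and x - y away from 0.\<close>
  define det :: "int \<times> int \<Rightarrow> int \<times> int \<Rightarrow> int" where
    "det x y = fst x * snd y - snd x * fst y" for x y
  have det0: "x \<noteq> 0 \<and> y \<noteq> 0" if "det x y \<noteq> 0" for x y
    using that by (auto simp: det_def)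
  have det_simps: "det (x + y) y = det x y" "det (x - y) y = det x y" "det (x + y) (x - y) = - 2 * det x y" for x y
    by (simp_all add: det_def algebra_simps)
  have det_swap: "det y x = - det x y" for x y by (simp add: det_def)
  have "det x y \<noteq> 0 \<Longrightarrow> l x + l y \<le> real k * \<epsilon> \<Longrightarrow> False" for k :: nat and x y
  proof (induction k arbitrary: x y)
    case 0
    then show ?case using l[of x] l[of y] det0[of x y] \<epsilon> by simp
  next
    case (Suc k)
    have *: False if d: "det x y \<noteq> 0" and s: "l x + l y \<le> real (Suc k) * \<epsilon>" and le: "l y \<le> l x"
      for x y
    proof -
      have nz: "x \<noteq> 0" "y \<noteq> 0" "x + y \<noteq> 0" "x - y \<noteq> 0"
        using det0[of x y] det0[of "x + y" "x - y"] d by (simp_all add: det_simps)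
      have mx: "max (l x) (l y) = l x" using le by simp
      have y: "\<epsilon> \<le> l y" using l nz by blast
      have "l x + l y \<le> l (x + y) \<or> l x + l y \<le> l (x - y)" using l_max[OF nz] by (simp add: le_max_iff_disj)
      then show False
      proof
        assume "l x + l y \<le> l (x + y)"
        \<comment> \<open>Subtracting the case assumption from \<open>l_sum\<close> leaves l (x - y)
          \<le> l x - l y, so the new sum is at most l x, which is the old sum less l y \<ge>
          \<epsilon>.\<close>
        then have "l (x - y) + l y \<le> real k * \<epsilon>" using l_sum[OF nz] mx s y by (simp add: algebra_simps)
        then show False using Suc.IH[of "x - y" y] d by (simp add: det_simps)
      next
        assume "l x + l y \<le> l (x - y)"
        then have "l (x + y) + l y \<le> real k * \<epsilon>" using l_sum[OF nz] mx s y by (simp add: algebra_simps)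
        then show False using Suc.IH[of "x + y" y] d by (simp add: det_simps)
      qed
    qed
    show ?case
    proof (cases "l y \<le> l x")
      case True
      then show ?thesis using *[OF Suc.prems] by blast
    next
      case False
      then show ?thesis using *[of y x] Suc.prems det_swap[of x y] by (simp add: add.commute)
    qed
  qed
  moreover obtain k :: nat where "l (1, 0) + l (0, 1) \<le> real k * \<epsilon>"
    using reals_Archimedean3[OF \<epsilon>] less_imp_le by blast
  moreover have "det (1, 0) (0, 1) \<noteq> 0" by (simp add: det_def)
  ultimately show False by blast
qed

text \<open>Doubling and rearranging the Gromov products removes the special role of the base point,
  leaving a comparison of the three pairings of four points.\<close>

lemma delta_hyperbolic_four_point:
  assumes hyp: "delta_hyperbolic \<delta> X d"
    and sym: "\<And>x y. d x y = d y x" and mem: "w \<in> X" "x \<in> X" "y \<in> X" "z \<in> X"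
  shows "d x y + d z w \<le> max (d x z + d y w) (d x w + d y z) + 2 * \<delta>"
proof -
  have "min (Gromov_product d w x z) (Gromov_product d w y z) - \<delta> \<le> Gromov_product d w x y"
    using hyp mem unfolding delta_hyperbolic_def by blast
  then show ?thesis
    unfolding Gromov_product_def by (auto simp: min_def max_def field_simps split: if_splits)
qed

section \<open>Flat groups and hyperbolic orbits\<close>

context topological_group
begin

text \<open>\<open>H\<close> contains the inverse of \<alpha>, for which \<open>W\<close> is
  minimizing as well; its minimality, transported by \<alpha>, is the second condition.\<close>

lemma minimizing_orbitI:
  assumes H: "subgroup H (top_Aut G T)" and W: "minimizing_for_all G T H W" and a: "\<alpha> \<in> H"
  shows "minimizing_orbit G T \<alpha> W"
proof -
  have Wco: "W \<in> compact_open_subgroups G T" using W by (simp add: minimizing_for_all_def)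
  have min: "coset_count W (\<beta> ` W) \<le> coset_count X (\<beta> ` X)"
    if b: "\<beta> \<in> H" and X: "X \<in> compact_open_subgroups G T" for \<beta> X
  proof -
    have bc: "\<beta> \<in> carrier (top_Aut G T)" using H b by (rule subgroup.mem_carrier)
    have eq: "subgroup_index G (\<beta> ` Z) (\<beta> ` Z \<inter> Z) = coset_count Z (\<beta> ` Z)"
      if "Z \<in> compact_open_subgroups G T" for Z
      using that bc by (intro subgroup_index_eq_coset_count compact_open_subgroupsD(1)
          top_Aut_image_compact_open)
    have "coset_count W (\<beta> ` W) = aut_scale G T \<beta>"
      using W b eq[OF Wco] by (simp add: minimizing_for_all_def minimizing_def)
    also have "\<dots> \<le> coset_count X (\<beta> ` X)"
      unfolding aut_scale_def by (rule Least_le) (use X eq[OF X] in force)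
    finally show ?thesis .
  qed
  let ?\<beta> = "inv\<^bsub>top_Aut G T\<^esub> \<alpha>"
  have ac: "\<alpha> \<in> carrier (top_Aut G T)" using H a by (rule subgroup.mem_carrier)
  have b: "?\<beta> \<in> H" using H a by (rule subgroup.m_inv_closed)
  have eq: "coset_count (\<alpha> ` X) X = coset_count X (?\<beta> ` X)" if X: "X \<subseteq> carrier G" for X
  proof -
    have "?\<beta> ` X \<subseteq> carrier G" using top_AutD(3)[of ?\<beta>] ac X by auto
    then show ?thesis
      using coset_count_image[OF ac X, of "?\<beta> ` X"] top_Aut_image_inv[OF ac X] by simp
  qed
  show ?thesis
  proof (intro minimizing_orbit.intro minimizing_orbit_axioms.intro topological_group_axioms ac Wco)
    fix X assume X: "X \<in> compact_open_subgroups G T"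
    show "coset_count W (\<alpha> ` W) \<le> coset_count X (\<alpha> ` X)" by (rule min[OF a X])
    show "coset_count (\<alpha> ` W) W \<le> coset_count (\<alpha> ` X) X"
      using min[OF b X] eq compact_open_subgroupsD(4) X Wco by simp
  qed
qed

text \<open>A conjugate \<open>?b\<close> of an element of the stabilizer by x fixes x(W). Its
  minimal indices are thus 1 in both directions, and since they are attained at \<open>W\<close>, it
  fixes \<open>W\<close>.\<close>

lemma flat_stabilizer_normal:
  assumes H: "subgroup H (top_Aut G T)" and W: "minimizing_for_all G T H W"
  shows "{\<alpha>\<in>H. \<alpha> ` W = W} \<lhd> (top_Aut G T)\<lparr>carrier := H\<rparr>"
proof -
  let ?A = "top_Aut G T"
  let ?H = "?A\<lparr>carrier := H\<rparr>" and ?K = "{\<alpha>\<in>H. \<alpha> ` W = W}"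
  interpret H: group ?H by (rule Aut.subgroup_imp_group[OF H])
  have Hc: "\<alpha> \<in> carrier ?A" if "\<alpha> \<in> H" for \<alpha> using H that by (rule subgroup.mem_carrier)
  have Wco: "W \<in> compact_open_subgroups G T" using W by (simp add: minimizing_for_all_def)
  have Wc: "W \<subseteq> carrier G" by (rule compact_open_subgroupsD(4)[OF Wco])
  have inv_eq: "inv\<^bsub>?H\<^esub> x = inv\<^bsub>?A\<^esub> x" if "x \<in> H" for x
    by (rule Aut.m_inv_consistent[OF H that])
  have fixinv: "(inv\<^bsub>?A\<^esub> x) ` W = W" if "x \<in> H" "x ` W = W" for x
    using top_Aut_image_inv(1)[OF Hc[OF that(1)] Wc] that(2) by simp
  have "subgroup ?K ?H"
  proof (rule H.subgroupI)
    have "\<one>\<^bsub>?A\<^esub> \<in> ?K" using subgroup.one_closed[OF H] top_Aut_image_one[OF Wc] by simp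
    then show "?K \<noteq> {}" by blast
  next
    fix x assume x: "x \<in> ?K"
    then have "inv\<^bsub>?A\<^esub> x \<in> ?K" using fixinv subgroup.m_inv_closed[OF H] by simp
    then show "inv\<^bsub>?H\<^esub> x \<in> ?K" using inv_eq x by simp
  next
    fix x y assume "x \<in> ?K" "y \<in> ?K"
    then show "x \<otimes>\<^bsub>?H\<^esub> y \<in> ?K"
      using subgroup.m_closed[OF H] top_Aut_image_mult[OF Hc Hc Wc] by simp
  qed simp
  moreover have "x \<otimes>\<^bsub>?H\<^esub> k \<otimes>\<^bsub>?H\<^esub> inv\<^bsub>?H\<^esub> x \<in> ?K" if x: "x \<in> H" and k: "k \<in> ?K" for x k
  proof -
    let ?b = "x \<otimes>\<^bsub>?A\<^esub> k \<otimes>\<^bsub>?A\<^esub> inv\<^bsub>?A\<^esub> x"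
    have b: "?b \<in> H"
      using x k by (auto intro!: subgroup.m_closed[OF H] subgroup.m_inv_closed[OF H])
    have xW: "x ` W \<in> compact_open_subgroups G T" by (rule top_Aut_image_compact_open[OF Hc[OF x] Wco])
    have ix: "inv\<^bsub>?A\<^esub> x \<in> carrier ?A" using Hc[OF x] by simp
    have "?b ` x ` W = x ` k ` (inv\<^bsub>?A\<^esub> x) ` x ` W"
      using x k Hc ix compact_open_subgroupsD(4)[OF xW]
        compact_open_subgroupsD(4)[OF top_Aut_image_compact_open[OF ix xW]]
      by (simp add: top_Aut_image_mult)
    then have bx: "?b ` x ` W = x ` W"
      using k top_Aut_image_inv(1)[OF Hc[OF x] Wc] by simp
    interpret b: minimizing_orbit G T ?b W by (rule minimizing_orbitI[OF H W b])
    have bW: "?b ` W \<in> compact_open_subgroups G T" by (rule top_Aut_image_compact_open[OF Hc[OF b] Wco])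
    have one: "coset_count (x ` W) (x ` W) = 1"
      using coset_count_eq_1_iff xW compact_open_subgroupsD(1) by blast
    have "coset_count W (?b ` W) = 1" "coset_count (?b ` W) W = 1"
      using b.minimal[OF xW] b.minimal_inv[OF xW] bx one
        coset_count_compact_open_pos[OF bW Wco] coset_count_compact_open_pos[OF Wco bW] by simp_all
    then have "?b ` W = W"
      using coset_count_eq_1_iff[OF compact_open_subgroupsD(1)[OF bW] compact_open_subgroupsD(1)[OF Wco]]
        coset_count_eq_1_iff[OF compact_open_subgroupsD(1)[OF Wco] compact_open_subgroupsD(1)[OF bW]]
      by blast
    then show ?thesis using b inv_eq[OF x] by simp
  qed
  ultimately show ?thesis unfolding H.normal_inv_iff by simp
qed

text \<open>Hyperbolicity is given at \<open>V\<close>, but growth is known at the minimizing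
  \<open>W\<close>. The exchange changes each distance by at most twice d(V, W); two distances on
  the left and two in each sum on the right make the factor 8.\<close>

lemma hyperbolic_orbit_four_point:
  assumes hyp: "delta_hyperbolic \<delta> ((\<lambda>\<alpha>. \<alpha> ` V) ` A) (subgroup_dist G)"
    and A: "A \<subseteq> carrier (top_Aut G T)"
    and V: "V \<in> compact_open_subgroups G T" and W: "W \<in> compact_open_subgroups G T"
    and mem: "\<alpha> \<in> A" "\<beta> \<in> A" "\<gamma> \<in> A" "\<eta> \<in> A"
  defines "d \<equiv> \<lambda>\<alpha> \<beta>. subgroup_dist G (\<alpha> ` W) (\<beta> ` W)"
  shows "d \<alpha> \<beta> + d \<gamma> \<eta> \<le> max (d \<alpha> \<gamma> + d \<beta> \<eta>) (d \<alpha> \<eta> + d \<beta> \<gamma>)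
    + (2 * \<delta> + 8 * subgroup_dist G V W)"
proof -
  let ?e = "\<lambda>\<alpha> \<beta>. subgroup_dist G (\<alpha> ` V) (\<beta> ` V)" and ?D = "subgroup_dist G V W"
  have close: "d \<alpha> \<beta> \<le> ?e \<alpha> \<beta> + 2 * ?D" "?e \<alpha> \<beta> \<le> d \<alpha> \<beta> + 2 * ?D"
    if "\<alpha> \<in> A" "\<beta> \<in> A" for \<alpha> \<beta>
  proof -
    have c: "\<alpha> \<in> carrier (top_Aut G T)" "\<beta> \<in> carrier (top_Aut G T)" using that A by auto
    note co = top_Aut_image_compact_open[OF c(1) V] top_Aut_image_compact_open[OF c(2) V]
      top_Aut_image_compact_open[OF c(1) W] top_Aut_image_compact_open[OF c(2) W]
    have D: "subgroup_dist G (\<alpha> ` V) (\<alpha> ` W) = ?D" "subgroup_dist G (\<beta> ` V) (\<beta> ` W) = ?D"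
      using c V W by (simp_all add: subgroup_dist_image)
    show "d \<alpha> \<beta> \<le> ?e \<alpha> \<beta> + 2 * ?D"
      using subgroup_dist_triangle[OF co(3,1,4)] subgroup_dist_triangle[OF co(1,2,4)] D
        subgroup_dist_sym[of "\<alpha> ` V" "\<alpha> ` W"] unfolding d_def by linarith
    show "?e \<alpha> \<beta> \<le> d \<alpha> \<beta> + 2 * ?D"
      using subgroup_dist_triangle[OF co(1,3,2)] subgroup_dist_triangle[OF co(3,4,2)] D
        subgroup_dist_sym[of "\<beta> ` V" "\<beta> ` W"] unfolding d_def by linarith
  qed
  have "?e \<alpha> \<beta> + ?e \<gamma> \<eta> \<le> max (?e \<alpha> \<gamma> + ?e \<beta> \<eta>) (?e \<alpha> \<eta> + ?e \<beta> \<gamma>) + 2 * \<delta>"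
    by (rule delta_hyperbolic_four_point[OF hyp subgroup_dist_sym]) (use mem in auto)
  moreover have "max (?e \<alpha> \<gamma> + ?e \<beta> \<eta>) (?e \<alpha> \<eta> + ?e \<beta> \<gamma>)
      \<le> max (d \<alpha> \<gamma> + d \<beta> \<eta>) (d \<alpha> \<eta> + d \<beta> \<gamma>) + 4 * ?D"
    using close(2)[OF mem(1,3)] close(2)[OF mem(2,4)] close(2)[OF mem(1,4)] close(2)[OF mem(2,3)]
    by linarith
  ultimately show ?thesis using close(1)[OF mem(1,2)] close(1)[OF mem(3,4)] by linarith
qed

text \<open>In rank at least 2, lifts of two basis elements of the quotient give translates of
  \<open>W\<close> indexed by pairs of integers, whose distances depend only on the difference of
  indices. This contradicts \<open>linear_growth_int2_not_hyperbolic\<close>.\<close>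

lemma hyperbolic_orbit_rank_of_flat_le:
  assumes hyp: "Gromov_hyperbolic ((\<lambda>\<alpha>. \<alpha> ` V) ` A) (subgroup_dist G)"
    and A: "A \<subseteq> carrier (top_Aut G T)" and V: "V \<in> compact_open_subgroups G T"
    and flat: "flat G T H" and HA: "H \<subseteq> A"
  shows "rank_of_flat G T H \<le> 1"
proof (rule ccontr)
  assume rank: "\<not> rank_of_flat G T H \<le> 1"
  let ?A = "top_Aut G T"
  let ?H = "?A\<lparr>carrier := H\<rparr>"
  obtain W where H: "subgroup H ?A" and W: "minimizing_for_all G T H W"
    using flat by (auto simp: flat_def)
  define K where "K = {\<alpha>\<in>H. \<alpha> ` W = W}"
  have Wco: "W \<in> compact_open_subgroups G T" using W by (simp add: minimizing_for_all_def)
  have Wc: "W \<subseteq> carrier G" by (rule compact_open_subgroupsD(4)[OF Wco])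
  have Hc: "\<alpha> \<in> carrier ?A" if "\<alpha> \<in> H" for \<alpha> using H that by (rule subgroup.mem_carrier)
  interpret H: group ?H by (rule Aut.subgroup_imp_group[OF H])
  interpret K: normal K ?H unfolding K_def by (rule flat_stabilizer_normal[OF H W])
  let ?Q = "?H Mod K"
  have "\<not> free_abelian_rank ?Q \<le> 1"
    using rank flat_kernel_eq[OF H W] by (simp add: rank_of_flat_def K_def)
  \<comment> \<open>The default rank 0 is excluded, so the quotient is free abelian on the chosen
    set \<open>S\<close>.\<close>
  then obtain S :: "('a \<Rightarrow> 'a) set set" where "\<not> ecard S \<le> 1" and QS: "?Q \<cong> free_Abelian_group S"
    unfolding free_abelian_rank_def
    by (metis (mono_tags, lifting) someI_ex zero_le)
  then have "\<not> (finite S \<and> card S \<le> 1)" by (auto simp: ecard_def one_enat_def)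
  then have "\<not> S \<subseteq> {x}" for x
    using card_mono[of "{x}" S] finite_subset[of S "{x}"] by auto
  then obtain s t where st: "s \<in> S" "t \<in> S" "s \<noteq> t" by blast
  let ?F = "free_Abelian_group S"
  obtain f where f: "f \<in> iso ?Q ?F" using QS by (auto simp: is_iso_def)
  define \<phi> where "\<phi> = f \<circ> (\<lambda>a. K #>\<^bsub>?H\<^esub> a)"
  have \<phi>hom: "\<phi> \<in> hom ?H ?F"
    unfolding \<phi>_def using f by (intro Group.hom_compose[OF K.r_coset_hom_Mod]) (simp add: iso_def)
  have surj: "\<exists>a\<in>H. \<phi> a = x" if x: "x \<in> carrier ?F" for x
  proof -
    have "f ` carrier ?Q = carrier ?F" using f by (simp add: iso_def bij_betw_def)
    then have "x \<in> f ` carrier ?Q" using x by (simp only:)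
    then obtain q where q: "q \<in> carrier ?Q" "x = f q" by (rule imageE) metis
    then obtain a where "a \<in> H" "q = K #>\<^bsub>?H\<^esub> a"
      unfolding FactGroup_def RCOSETS_def by (simp only: partial_object.simps) force
    then show ?thesis using q(2) unfolding \<phi>_def comp_def by blast
  qed
  have HmA: "a \<otimes>\<^bsub>?A\<^esub> b \<in> H" if "a \<in> H" "b \<in> H" for a b
    using H that by (rule subgroup.m_closed)
  have HiA: "inv\<^bsub>?A\<^esub> a \<in> H" if "a \<in> H" for a using H that by (rule subgroup.m_inv_closed)
  have HpA: "a [^]\<^bsub>?A\<^esub> (n::int) \<in> H" if "a \<in> H" for a n
    using H.int_pow_closed[of a n] that Aut.int_pow_consistent[OF H that, of n] by simp
  have \<phi>_mult: "\<phi> (a \<otimes>\<^bsub>?A\<^esub> b) = \<phi> a + \<phi> b" if "a \<in> H" "b \<in> H" for a b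
    using hom_mult[OF \<phi>hom, of a b] that by simp
  have \<phi>_one: "\<phi> \<one>\<^bsub>?A\<^esub> = 0"
    using \<phi>_mult[OF subgroup.one_closed[OF H] subgroup.one_closed[OF H]] by simp
  have \<phi>_inv: "\<phi> (inv\<^bsub>?A\<^esub> a) = - \<phi> a" if "a \<in> H" for a
    using \<phi>_mult[OF HiA[OF that] that] \<phi>_one Hc[OF that] by (simp add: eq_neg_iff_add_eq_0)
  have \<phi>_pow: "\<phi> (a [^]\<^bsub>?A\<^esub> (n::int)) = frag_cmul n (\<phi> a)" if a: "a \<in> H" for a n
  proof -
    have "\<phi> a \<in> carrier ?F"
      by (rule hom_in_carrier[OF \<phi>hom]) (use a in simp)
    then have "\<phi> a [^]\<^bsub>?F\<^esub> n = frag_cmul n (\<phi> a)" by (intro int_pow_free_Abelian_group) simp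
    moreover have "\<phi> (a [^]\<^bsub>?H\<^esub> n) = \<phi> a [^]\<^bsub>?F\<^esub> n"
      by (rule Group.hom_int_pow[OF \<phi>hom]) (use a H.is_group in auto)
    ultimately show ?thesis using Aut.int_pow_consistent[OF H a, of n] by simp
  qed
  have K: "subgroup K ?A" using Aut.incl_subgroup[OF H] K.is_subgroup by blast
  have ker: "a \<in> K \<longleftrightarrow> \<phi> a = 0" if a: "a \<in> H" for a
  proof -
    have "inj_on f (carrier ?Q)" using f by (simp add: iso_def bij_betw_def)
    moreover have "K #>\<^bsub>?A\<^esub> a \<in> carrier ?Q" "K #>\<^bsub>?A\<^esub> \<one>\<^bsub>?A\<^esub> \<in> carrier ?Q"
      using a subgroup.one_closed[OF H] by (auto simp: FactGroup_def RCOSETS_def)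
    ultimately have "\<phi> a = \<phi> \<one>\<^bsub>?A\<^esub> \<longleftrightarrow> K #>\<^bsub>?A\<^esub> a = K #>\<^bsub>?A\<^esub> \<one>\<^bsub>?A\<^esub>"
      unfolding \<phi>_def comp_def r_coset_consistent by (rule inj_on_eq_iff)
    also have "\<dots> \<longleftrightarrow> a \<in> K"
      using Aut.r_coset_eq_iff[OF K Hc[OF a] Aut.one_closed] Hc[OF a] by simp
    finally show ?thesis by (simp add: \<phi>_one)
  qed
  \<comment> \<open>Elements of \<open>H\<close> with the same image under \<open>\<phi>\<close>
    differ by an element of \<open>K\<close>, which fixes \<open>W\<close>. This allows computing
    with translates of \<open>W\<close> in the free abelian group.\<close>
  have \<phi>_eq: "a ` W = b ` W" if a: "a \<in> H" and b: "b \<in> H" and eq: "\<phi> a = \<phi> b" for a b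
  proof -
    have "inv\<^bsub>?A\<^esub> b \<otimes>\<^bsub>?A\<^esub> a \<in> K"
      using ker[OF HmA[OF HiA[OF b] a]] \<phi>_mult[OF HiA[OF b] a] \<phi>_inv[OF b] eq by simp
    then have "(inv\<^bsub>?A\<^esub> b \<otimes>\<^bsub>?A\<^esub> a) ` W = W" by (simp add: K_def)
    then have "(inv\<^bsub>?A\<^esub> b) ` a ` W = W"
      using top_Aut_image_mult[OF Hc[OF HiA[OF b]] Hc[OF a] Wc] by (simp only:)
    then have "b ` (inv\<^bsub>?A\<^esub> b) ` a ` W = b ` W" by (simp only:)
    moreover have "a ` W \<subseteq> carrier G" using top_AutD(3)[OF Hc[OF a]] Wc by blast
    ultimately show ?thesis using top_Aut_image_inv(2)[OF Hc[OF b]] by (simp only:)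
  qed
  obtain gs gt where gs: "gs \<in> H" "\<phi> gs = frag_of s" and gt: "gt \<in> H" "\<phi> gt = frag_of t"
    using surj[of "frag_of s"] surj[of "frag_of t"] st by auto
  \<comment> \<open>The lifts commute modulo \<open>K\<close>, so \<open>g\<close> is treated as
    additive only after applying \<open>\<phi>\<close>.\<close>
  define g where "g u = gs [^]\<^bsub>?A\<^esub> fst u \<otimes>\<^bsub>?A\<^esub> gt [^]\<^bsub>?A\<^esub> snd u" for u :: "int \<times> int"
  have gH: "g u \<in> H" for u unfolding g_def using gs(1) gt(1) by (intro HmA HpA)
  have \<phi>g: "\<phi> (g u) = frag_cmul (fst u) (frag_of s) + frag_cmul (snd u) (frag_of t)" for u
    unfolding g_def \<phi>_mult[OF HpA[OF gs(1)] HpA[OF gt(1)]] \<phi>_pow[OF gs(1)] \<phi>_pow[OF gt(1)] gs(2) gt(2) ..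
  define M where "M u = subgroup_dist G W (g u ` W)" for u
  have gco: "g u ` W \<in> compact_open_subgroups G T" for u
    by (rule top_Aut_image_compact_open[OF Hc[OF gH] Wco])
  have dist: "subgroup_dist G (g u ` W) (g v ` W) = M (v - u)" for u v
  proof -
    let ?i = "inv\<^bsub>?A\<^esub> (g u)"
    have iH: "?i \<in> H" by (rule HiA[OF gH])
    have "subgroup_dist G (g u ` W) (g v ` W) = subgroup_dist G (?i ` g u ` W) (?i ` g v ` W)"
      by (rule subgroup_dist_image[symmetric, OF Hc[OF iH] gco gco])
    also have "?i ` g u ` W = W" by (rule top_Aut_image_inv(1)[OF Hc[OF gH] Wc])
    also have "?i ` g v ` W = (?i \<otimes>\<^bsub>?A\<^esub> g v) ` W"
      by (rule top_Aut_image_mult[symmetric, OF Hc[OF iH] Hc[OF gH] Wc])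
    also have "\<dots> = g (v - u) ` W"
    proof (rule \<phi>_eq[OF HmA[OF iH gH] gH])
      show "\<phi> (?i \<otimes>\<^bsub>?A\<^esub> g v) = \<phi> (g (v - u))"
        unfolding \<phi>_mult[OF iH gH] \<phi>_inv[OF gH] by (simp add: \<phi>g frag_cmul_diff_distrib)
    qed
    finally show ?thesis by (simp add: M_def)
  qed
  obtain \<delta> where \<delta>: "delta_hyperbolic \<delta> ((\<lambda>\<alpha>. \<alpha> ` V) ` A) (subgroup_dist G)"
    using hyp by (auto simp: Gromov_hyperbolic_def)
  show False
  proof (rule linear_growth_int2_not_hyperbolic[of M "ln 2" "2 * \<delta> + 8 * subgroup_dist G V W"])
    show sym: "M (- u) = M u" for u
      using dist[of u 0] dist[of 0 u] subgroup_dist_sym by simp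
    show "(0::real) < ln 2" by simp
    \<comment> \<open>The points are passed in swapped order since \<open>dist\<close> attaches
      \<open>v - u\<close> to the pair u, v; symmetry of \<open>M\<close> adjusts the signs on the
      right.\<close>
    show "M (a - b) + M (c - d) \<le> max (M (a - c) + M (b - d)) (M (a - d) + M (b - c))
        + (2 * \<delta> + 8 * subgroup_dist G V W)" for a b c d
      using hyperbolic_orbit_four_point[OF \<delta> A V Wco, of "g b" "g a" "g d" "g c"] gH HA
        sym[of "a - c"] sym[of "b - d"] sym[of "a - d"] sym[of "b - c"]
      by (simp add: dist subset_iff add.commute)
    fix u :: "int \<times> int" assume u: "u \<noteq> 0"
    interpret u: minimizing_orbit G T "g u" W by (rule minimizing_orbitI[OF H W gH])
    obtain l C where lC: "l = 0 \<and> g u ` W = W \<or> ln 2 \<le> l"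
      "\<And>n. \<bar>subgroup_dist G W ((g u [^]\<^bsub>?A\<^esub> int n) ` W) - real n * l\<bar> \<le> C"
      using u.subgroup_dist_pow_growth by blast
    \<comment> \<open>Fixing \<open>W\<close> would be a linear relation between the distinct basis
      elements \<open>s\<close> and \<open>t\<close>; reading off its coefficients gives u =
      0.\<close>
    have "g u ` W \<noteq> W"
    proof
      assume "g u ` W = W"
      then have "g u \<in> K" using gH by (simp add: K_def)
      then have *: "frag_cmul (fst u) (frag_of s) + frag_cmul (snd u) (frag_of t) = 0"
        using ker[OF gH] \<phi>g by simp
      have "fst u = 0" "snd u = 0"
        using arg_cong[OF *, of "\<lambda>x. poly_mapping.lookup x s"]
          arg_cong[OF *, of "\<lambda>x. poly_mapping.lookup x t"] st
        by (simp_all add: lookup_add)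
      then show False using u by (simp add: prod_eq_iff)
    qed
    then have "ln 2 \<le> l" using lC(1) by blast
    moreover have "M (scale2 n u) = subgroup_dist G W ((g u [^]\<^bsub>?A\<^esub> int n) ` W)" for n
    proof -
      have "\<phi> (g u [^]\<^bsub>?A\<^esub> int n) = \<phi> (g (scale2 n u))"
        unfolding \<phi>_pow[OF gH] by (simp add: \<phi>g scale2_def frag_cmul_distrib2)
      then show ?thesis unfolding M_def using \<phi>_eq[OF HpA[OF gH] gH] by simp
    qed
    ultimately show "\<exists>l C. ln 2 \<le> l \<and> (\<forall>n. \<bar>M (scale2 n u) - real n * l\<bar> \<le> C)"
      using lC(2) by auto
  qed
qed

end

theorem theorem2:
  fixes G :: "('a, 'b) monoid_scheme" and T :: "'a topology"
    and A :: "('a \<Rightarrow> 'a) set" and V :: "'a set"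
  assumes "tdlc_group G T"
    and "subgroup A (top_Aut G T)"
    and "V \<in> compact_open_subgroups G T"
    and "Gromov_hyperbolic ((\<lambda>\<alpha>. \<alpha> ` V) ` A) (subgroup_dist G)"
  shows "flat_rank G T A \<le> 1"
proof -
  interpret tdlc_group G T by fact
  show ?thesis
    unfolding flat_rank_def
    by (intro SUP_least hyperbolic_orbit_rank_of_flat_le[OF assms(4) subgroup.subset[OF assms(2)] assms(3)])
      auto
qed

end
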